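(* Let $\mathcal{C}$ be a rigid tensor category over a field $k$, and let $V,W\in\mathcal{C}$. Assume that $W$ is isomorphic to its double dual $W^{**}$ and let $i:W\to W^{**}$ be an isomorphism. If $V\otimes W$ is semisimple and $\dim_i(W)\neq 0$ in $k$, then $V$ is semisimple.
   Context: All tensor categories over $k$ are rigid, $k$-linear abelian, with finite dimensional $\operatorname{Hom}$ spaces, with every object of finite length, and with $\operatorname{End}(\mathbf{1})=k$. No braiding or symmetry is assumed. For an object $X$, $coev_X:\mathbf 1\to X\otimes X^*$ and $ev_X:X^*\otimes X\to\mathbf 1$ denote the coevaluation and evaluation maps. For an isomorphism $i:W\to W^{**}$, the (quantum) dimension of $W$ relative to $i$ is the scalar $$\dim_i(W):=ev_{W^*}\circ(i\otimes id_{W^*})\circ coev_W\in\operatorname{End}(\mathbf 1)=k.$$ *)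

theory Defs
  imports "Jordan_Normal_Form.Missing_VectorSpace"
begin

section \<open>Linear categories\<close>

text \<open>
  The Hom-spaces are module records, so that an element of \<open>K\<close> acts on them by
  \<open>\<odot>\<close> and \<open>vectorspace.fin_dim\<close> applies. They live in one common type of morphisms and are
  not required to be pairwise disjoint; for this reason the notions below mention source and
  target explicitly. Composition is written in the usual order: \<open>g \<cdot> f\<close> is \<open>g\<close> after \<open>f\<close>.
\<close>

record ('k, 'o, 'm) lin_cat =
  Obj :: "'o set"
  Hom :: "'o \<Rightarrow> 'o \<Rightarrow> ('k, 'm) module"
  Id :: "'o \<Rightarrow> 'm"
  Comp :: "'m \<Rightarrow> 'm \<Rightarrow> 'm" (infixl \<open>\<cdot>\<index>\<close> 65)

abbreviation arr :: "('k, 'o, 'm, 'z) lin_cat_scheme \<Rightarrow> 'o \<Rightarrow> 'o \<Rightarrow> 'm set" where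
  "arr C X Y \<equiv> carrier (Hom C X Y)"

locale category =
  fixes C :: "('k, 'o, 'm, 'z) lin_cat_scheme"
  assumes Id_closed: "X \<in> Obj C \<Longrightarrow> Id C X \<in> arr C X X"
    and Comp_closed:
      "\<lbrakk>X \<in> Obj C; Y \<in> Obj C; Z \<in> Obj C; f \<in> arr C X Y; g \<in> arr C Y Z\<rbrakk>
        \<Longrightarrow> g \<cdot>\<^bsub>C\<^esub> f \<in> arr C X Z"
    and Comp_Id_left: "\<lbrakk>X \<in> Obj C; Y \<in> Obj C; f \<in> arr C X Y\<rbrakk> \<Longrightarrow> Id C Y \<cdot>\<^bsub>C\<^esub> f = f"
    and Comp_Id_right: "\<lbrakk>X \<in> Obj C; Y \<in> Obj C; f \<in> arr C X Y\<rbrakk> \<Longrightarrow> f \<cdot>\<^bsub>C\<^esub> Id C X = f"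
    and Comp_assoc:
      "\<lbrakk>X \<in> Obj C; Y \<in> Obj C; Z \<in> Obj C; W \<in> Obj C;
        f \<in> arr C X Y; g \<in> arr C Y Z; h \<in> arr C Z W\<rbrakk>
        \<Longrightarrow> (h \<cdot>\<^bsub>C\<^esub> g) \<cdot>\<^bsub>C\<^esub> f = h \<cdot>\<^bsub>C\<^esub> (g \<cdot>\<^bsub>C\<^esub> f)"

locale linear_category = K?: field K + category C
  for K :: "('k, 'r) ring_scheme" and C :: "('k, 'o, 'm, 'z) lin_cat_scheme" +
  assumes Hom_vectorspace: "\<lbrakk>X \<in> Obj C; Y \<in> Obj C\<rbrakk> \<Longrightarrow> vectorspace K (Hom C X Y)"
    and Comp_add_left:
      "\<lbrakk>X \<in> Obj C; Y \<in> Obj C; Z \<in> Obj C; f \<in> arr C X Y; g \<in> arr C Y Z; h \<in> arr C Y Z\<rbrakk>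
        \<Longrightarrow> (g \<oplus>\<^bsub>Hom C Y Z\<^esub> h) \<cdot>\<^bsub>C\<^esub> f = (g \<cdot>\<^bsub>C\<^esub> f) \<oplus>\<^bsub>Hom C X Z\<^esub> (h \<cdot>\<^bsub>C\<^esub> f)"
    and Comp_add_right:
      "\<lbrakk>X \<in> Obj C; Y \<in> Obj C; Z \<in> Obj C; f \<in> arr C X Y; g \<in> arr C X Y; h \<in> arr C Y Z\<rbrakk>
        \<Longrightarrow> h \<cdot>\<^bsub>C\<^esub> (f \<oplus>\<^bsub>Hom C X Y\<^esub> g) = (h \<cdot>\<^bsub>C\<^esub> f) \<oplus>\<^bsub>Hom C X Z\<^esub> (h \<cdot>\<^bsub>C\<^esub> g)"
    and Comp_smult_left:
      "\<lbrakk>X \<in> Obj C; Y \<in> Obj C; Z \<in> Obj C; a \<in> carrier K; f \<in> arr C X Y; g \<in> arr C Y Z\<rbrakk>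
        \<Longrightarrow> (a \<odot>\<^bsub>Hom C Y Z\<^esub> g) \<cdot>\<^bsub>C\<^esub> f = a \<odot>\<^bsub>Hom C X Z\<^esub> (g \<cdot>\<^bsub>C\<^esub> f)"
    and Comp_smult_right:
      "\<lbrakk>X \<in> Obj C; Y \<in> Obj C; Z \<in> Obj C; a \<in> carrier K; f \<in> arr C X Y; g \<in> arr C Y Z\<rbrakk>
        \<Longrightarrow> g \<cdot>\<^bsub>C\<^esub> (a \<odot>\<^bsub>Hom C X Y\<^esub> f) = a \<odot>\<^bsub>Hom C X Z\<^esub> (g \<cdot>\<^bsub>C\<^esub> f)"

definition isomorphism :: "('k, 'o, 'm, 'z) lin_cat_scheme \<Rightarrow> 'o \<Rightarrow> 'o \<Rightarrow> 'm \<Rightarrow> bool" where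
  "isomorphism C X Y f \<longleftrightarrow> X \<in> Obj C \<and> Y \<in> Obj C \<and> f \<in> arr C X Y \<and>
     (\<exists>g \<in> arr C Y X. g \<cdot>\<^bsub>C\<^esub> f = Id C X \<and> f \<cdot>\<^bsub>C\<^esub> g = Id C Y)"

definition inverse_arr :: "('k, 'o, 'm, 'z) lin_cat_scheme \<Rightarrow> 'o \<Rightarrow> 'o \<Rightarrow> 'm \<Rightarrow> 'm" where
  "inverse_arr C X Y f =
     (THE g. g \<in> arr C Y X \<and> g \<cdot>\<^bsub>C\<^esub> f = Id C X \<and> f \<cdot>\<^bsub>C\<^esub> g = Id C Y)"

definition monic :: "('k, 'o, 'm, 'z) lin_cat_scheme \<Rightarrow> 'o \<Rightarrow> 'o \<Rightarrow> 'm \<Rightarrow> bool" where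
  "monic C X Y f \<longleftrightarrow> X \<in> Obj C \<and> Y \<in> Obj C \<and> f \<in> arr C X Y \<and>
     (\<forall>Z \<in> Obj C. \<forall>g \<in> arr C Z X. \<forall>h \<in> arr C Z X. f \<cdot>\<^bsub>C\<^esub> g = f \<cdot>\<^bsub>C\<^esub> h \<longrightarrow> g = h)"

definition epic :: "('k, 'o, 'm, 'z) lin_cat_scheme \<Rightarrow> 'o \<Rightarrow> 'o \<Rightarrow> 'm \<Rightarrow> bool" where
  "epic C X Y f \<longleftrightarrow> X \<in> Obj C \<and> Y \<in> Obj C \<and> f \<in> arr C X Y \<and>
     (\<forall>Z \<in> Obj C. \<forall>g \<in> arr C Y Z. \<forall>h \<in> arr C Y Z. g \<cdot>\<^bsub>C\<^esub> f = h \<cdot>\<^bsub>C\<^esub> f \<longrightarrow> g = h)"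

definition zero_object :: "('k, 'o, 'm, 'z) lin_cat_scheme \<Rightarrow> 'o \<Rightarrow> bool" where
  "zero_object C Z \<longleftrightarrow> Z \<in> Obj C \<and>
     (\<forall>X \<in> Obj C. (\<exists>!f. f \<in> arr C Z X) \<and> (\<exists>!f. f \<in> arr C X Z))"

definition is_kernel ::
  "('k, 'o, 'm, 'z) lin_cat_scheme \<Rightarrow> 'o \<Rightarrow> 'o \<Rightarrow> 'm \<Rightarrow> 'o \<Rightarrow> 'm \<Rightarrow> bool" where
  "is_kernel C X Y f N n \<longleftrightarrow> N \<in> Obj C \<and> n \<in> arr C N X \<and> f \<cdot>\<^bsub>C\<^esub> n = \<zero>\<^bsub>Hom C N Y\<^esub> \<and>
     (\<forall>Z \<in> Obj C. \<forall>h \<in> arr C Z X. f \<cdot>\<^bsub>C\<^esub> h = \<zero>\<^bsub>Hom C Z Y\<^esub> \<longrightarrow>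
        (\<exists>!u. u \<in> arr C Z N \<and> n \<cdot>\<^bsub>C\<^esub> u = h))"

definition is_cokernel ::
  "('k, 'o, 'm, 'z) lin_cat_scheme \<Rightarrow> 'o \<Rightarrow> 'o \<Rightarrow> 'm \<Rightarrow> 'o \<Rightarrow> 'm \<Rightarrow> bool" where
  "is_cokernel C X Y f Q q \<longleftrightarrow> Q \<in> Obj C \<and> q \<in> arr C Y Q \<and> q \<cdot>\<^bsub>C\<^esub> f = \<zero>\<^bsub>Hom C X Q\<^esub> \<and>
     (\<forall>Z \<in> Obj C. \<forall>h \<in> arr C Y Z. h \<cdot>\<^bsub>C\<^esub> f = \<zero>\<^bsub>Hom C X Z\<^esub> \<longrightarrow>
        (\<exists>!u. u \<in> arr C Q Z \<and> u \<cdot>\<^bsub>C\<^esub> q = h))"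

text \<open>
  \<open>X\<close> is the direct sum of \<open>S 0, \<dots>, S (n - 1)\<close> with inclusions \<open>\<iota> i\<close> and projections \<open>\<pi> i\<close>.
  For \<open>n = 0\<close> this says that the identity of \<open>X\<close> is zero, i.e. that \<open>X\<close> is a zero object.
\<close>

definition is_direct_sum ::
  "('k, 'o, 'm, 'z) lin_cat_scheme \<Rightarrow> nat \<Rightarrow> (nat \<Rightarrow> 'o) \<Rightarrow> 'o \<Rightarrow> (nat \<Rightarrow> 'm) \<Rightarrow> (nat \<Rightarrow> 'm) \<Rightarrow> bool"
where
  "is_direct_sum C n S X \<iota> \<pi> \<longleftrightarrow> X \<in> Obj C \<and>
     (\<forall>i<n. S i \<in> Obj C \<and> \<iota> i \<in> arr C (S i) X \<and> \<pi> i \<in> arr C X (S i)) \<and>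
     (\<forall>i<n. \<forall>j<n. \<pi> i \<cdot>\<^bsub>C\<^esub> \<iota> j = (if i = j then Id C (S i) else \<zero>\<^bsub>Hom C (S j) (S i)\<^esub>)) \<and>
     (\<Oplus>\<^bsub>Hom C X X\<^esub> i \<in> {..<n}. \<iota> i \<cdot>\<^bsub>C\<^esub> \<pi> i) = Id C X"

locale abelian_linear_category = linear_category +
  assumes direct_sums_exist:
      "(\<And>i. i < n \<Longrightarrow> S i \<in> Obj C) \<Longrightarrow> \<exists>X \<iota> \<pi>. is_direct_sum C n S X \<iota> \<pi>"
    and kernels_exist:
      "\<lbrakk>X \<in> Obj C; Y \<in> Obj C; f \<in> arr C X Y\<rbrakk> \<Longrightarrow> \<exists>N n. is_kernel C X Y f N n"
    and cokernels_exist: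
      "\<lbrakk>X \<in> Obj C; Y \<in> Obj C; f \<in> arr C X Y\<rbrakk> \<Longrightarrow> \<exists>Q q. is_cokernel C X Y f Q q"
    and monic_is_kernel:
      "monic C X Y f \<Longrightarrow> \<exists>Z g. Z \<in> Obj C \<and> g \<in> arr C Y Z \<and> is_kernel C Y Z g X f"
    and epic_is_cokernel:
      "epic C X Y f \<Longrightarrow> \<exists>Z g. Z \<in> Obj C \<and> g \<in> arr C Z X \<and> is_cokernel C Z X g Y f"

definition simple_object :: "('k, 'o, 'm, 'z) lin_cat_scheme \<Rightarrow> 'o \<Rightarrow> bool" where
  "simple_object C X \<longleftrightarrow> X \<in> Obj C \<and> \<not> zero_object C X \<and>
     (\<forall>Y f. monic C Y X f \<longrightarrow> zero_object C Y \<or> isomorphism C Y X f)"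

definition semisimple_object :: "('k, 'o, 'm, 'z) lin_cat_scheme \<Rightarrow> 'o \<Rightarrow> bool" where
  "semisimple_object C X \<longleftrightarrow>
     (\<exists>n S \<iota> \<pi>. is_direct_sum C n S X \<iota> \<pi> \<and> (\<forall>i<n. simple_object C (S i)))"

text \<open>
  Existence of a composition series
  \<open>0 = F 0 \<hookrightarrow> F 1 \<hookrightarrow> \<dots> \<hookrightarrow> F n = X\<close> with simple quotients.
\<close>

definition finite_length :: "('k, 'o, 'm, 'z) lin_cat_scheme \<Rightarrow> 'o \<Rightarrow> bool" where
  "finite_length C X \<longleftrightarrow>
     (\<exists>n F f. zero_object C (F 0) \<and> F n = X \<and>
        (\<forall>i<n. monic C (F i) (F (Suc i)) (f i) \<and>
           (\<exists>Q q. is_cokernel C (F i) (F (Suc i)) (f i) Q q \<and> simple_object C Q)))"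


section \<open>Monoidal structure and duals\<close>

text \<open>
  \<open>X \<boxtimes> Y\<close> is the tensor product of objects and \<open>f \<boxdot> g\<close> that of morphisms.
\<close>

record ('k, 'o, 'm) monoidal_cat = "('k, 'o, 'm) lin_cat" +
  TensorObj :: "'o \<Rightarrow> 'o \<Rightarrow> 'o" (infixr \<open>\<boxtimes>\<index>\<close> 75)
  TensorArr :: "'m \<Rightarrow> 'm \<Rightarrow> 'm" (infixr \<open>\<boxdot>\<index>\<close> 75)
  UnitObj :: "'o"
  Assoc :: "'o \<Rightarrow> 'o \<Rightarrow> 'o \<Rightarrow> 'm"
  LUnit :: "'o \<Rightarrow> 'm"
  RUnit :: "'o \<Rightarrow> 'm"

locale monoidal_linear_category = linear_category K C
  for K :: "('k, 'r) ring_scheme" and C :: "('k, 'o, 'm, 'z) monoidal_cat_scheme" +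
  assumes UnitObj_closed: "UnitObj C \<in> Obj C"
    and TensorObj_closed: "\<lbrakk>X \<in> Obj C; Y \<in> Obj C\<rbrakk> \<Longrightarrow> X \<boxtimes>\<^bsub>C\<^esub> Y \<in> Obj C"
    and TensorArr_closed:
      "\<lbrakk>X \<in> Obj C; Y \<in> Obj C; X' \<in> Obj C; Y' \<in> Obj C; f \<in> arr C X Y; g \<in> arr C X' Y'\<rbrakk>
        \<Longrightarrow> f \<boxdot>\<^bsub>C\<^esub> g \<in> arr C (X \<boxtimes>\<^bsub>C\<^esub> X') (Y \<boxtimes>\<^bsub>C\<^esub> Y')"
    and TensorArr_Id:
      "\<lbrakk>X \<in> Obj C; Y \<in> Obj C\<rbrakk> \<Longrightarrow> Id C X \<boxdot>\<^bsub>C\<^esub> Id C Y = Id C (X \<boxtimes>\<^bsub>C\<^esub> Y)"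
    and TensorArr_Comp:
      "\<lbrakk>X \<in> Obj C; Y \<in> Obj C; Z \<in> Obj C; X' \<in> Obj C; Y' \<in> Obj C; Z' \<in> Obj C;
        f \<in> arr C X Y; g \<in> arr C Y Z; f' \<in> arr C X' Y'; g' \<in> arr C Y' Z'\<rbrakk>
        \<Longrightarrow> (g \<cdot>\<^bsub>C\<^esub> f) \<boxdot>\<^bsub>C\<^esub> (g' \<cdot>\<^bsub>C\<^esub> f') = (g \<boxdot>\<^bsub>C\<^esub> g') \<cdot>\<^bsub>C\<^esub> (f \<boxdot>\<^bsub>C\<^esub> f')"
    and TensorArr_add_left:
      "\<lbrakk>X \<in> Obj C; Y \<in> Obj C; X' \<in> Obj C; Y' \<in> Obj C;
        f \<in> arr C X Y; g \<in> arr C X Y; h \<in> arr C X' Y'\<rbrakk>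
        \<Longrightarrow> (f \<oplus>\<^bsub>Hom C X Y\<^esub> g) \<boxdot>\<^bsub>C\<^esub> h =
            (f \<boxdot>\<^bsub>C\<^esub> h) \<oplus>\<^bsub>Hom C (X \<boxtimes>\<^bsub>C\<^esub> X') (Y \<boxtimes>\<^bsub>C\<^esub> Y')\<^esub> (g \<boxdot>\<^bsub>C\<^esub> h)"
    and TensorArr_add_right:
      "\<lbrakk>X \<in> Obj C; Y \<in> Obj C; X' \<in> Obj C; Y' \<in> Obj C;
        f \<in> arr C X Y; g \<in> arr C X' Y'; h \<in> arr C X' Y'\<rbrakk>
        \<Longrightarrow> f \<boxdot>\<^bsub>C\<^esub> (g \<oplus>\<^bsub>Hom C X' Y'\<^esub> h) =
            (f \<boxdot>\<^bsub>C\<^esub> g) \<oplus>\<^bsub>Hom C (X \<boxtimes>\<^bsub>C\<^esub> X') (Y \<boxtimes>\<^bsub>C\<^esub> Y')\<^esub> (f \<boxdot>\<^bsub>C\<^esub> h)"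
    and TensorArr_smult_left:
      "\<lbrakk>X \<in> Obj C; Y \<in> Obj C; X' \<in> Obj C; Y' \<in> Obj C;
        a \<in> carrier K; f \<in> arr C X Y; g \<in> arr C X' Y'\<rbrakk>
        \<Longrightarrow> (a \<odot>\<^bsub>Hom C X Y\<^esub> f) \<boxdot>\<^bsub>C\<^esub> g = a \<odot>\<^bsub>Hom C (X \<boxtimes>\<^bsub>C\<^esub> X') (Y \<boxtimes>\<^bsub>C\<^esub> Y')\<^esub> (f \<boxdot>\<^bsub>C\<^esub> g)"
    and TensorArr_smult_right:
      "\<lbrakk>X \<in> Obj C; Y \<in> Obj C; X' \<in> Obj C; Y' \<in> Obj C;
        a \<in> carrier K; f \<in> arr C X Y; g \<in> arr C X' Y'\<rbrakk>
        \<Longrightarrow> f \<boxdot>\<^bsub>C\<^esub> (a \<odot>\<^bsub>Hom C X' Y'\<^esub> g) = a \<odot>\<^bsub>Hom C (X \<boxtimes>\<^bsub>C\<^esub> X') (Y \<boxtimes>\<^bsub>C\<^esub> Y')\<^esub> (f \<boxdot>\<^bsub>C\<^esub> g)"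
    and Assoc_iso:
      "\<lbrakk>X \<in> Obj C; Y \<in> Obj C; Z \<in> Obj C\<rbrakk>
        \<Longrightarrow> isomorphism C ((X \<boxtimes>\<^bsub>C\<^esub> Y) \<boxtimes>\<^bsub>C\<^esub> Z) (X \<boxtimes>\<^bsub>C\<^esub> (Y \<boxtimes>\<^bsub>C\<^esub> Z)) (Assoc C X Y Z)"
    and Assoc_natural:
      "\<lbrakk>X \<in> Obj C; Y \<in> Obj C; Z \<in> Obj C; X' \<in> Obj C; Y' \<in> Obj C; Z' \<in> Obj C;
        f \<in> arr C X X'; g \<in> arr C Y Y'; h \<in> arr C Z Z'\<rbrakk>
        \<Longrightarrow> Assoc C X' Y' Z' \<cdot>\<^bsub>C\<^esub> ((f \<boxdot>\<^bsub>C\<^esub> g) \<boxdot>\<^bsub>C\<^esub> h) =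
            (f \<boxdot>\<^bsub>C\<^esub> (g \<boxdot>\<^bsub>C\<^esub> h)) \<cdot>\<^bsub>C\<^esub> Assoc C X Y Z"
    and LUnit_iso: "X \<in> Obj C \<Longrightarrow> isomorphism C (UnitObj C \<boxtimes>\<^bsub>C\<^esub> X) X (LUnit C X)"
    and LUnit_natural:
      "\<lbrakk>X \<in> Obj C; Y \<in> Obj C; f \<in> arr C X Y\<rbrakk>
        \<Longrightarrow> LUnit C Y \<cdot>\<^bsub>C\<^esub> (Id C (UnitObj C) \<boxdot>\<^bsub>C\<^esub> f) = f \<cdot>\<^bsub>C\<^esub> LUnit C X"
    and RUnit_iso: "X \<in> Obj C \<Longrightarrow> isomorphism C (X \<boxtimes>\<^bsub>C\<^esub> UnitObj C) X (RUnit C X)"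
    and RUnit_natural:
      "\<lbrakk>X \<in> Obj C; Y \<in> Obj C; f \<in> arr C X Y\<rbrakk>
        \<Longrightarrow> RUnit C Y \<cdot>\<^bsub>C\<^esub> (f \<boxdot>\<^bsub>C\<^esub> Id C (UnitObj C)) = f \<cdot>\<^bsub>C\<^esub> RUnit C X"
    and pentagon:
      "\<lbrakk>W \<in> Obj C; X \<in> Obj C; Y \<in> Obj C; Z \<in> Obj C\<rbrakk>
        \<Longrightarrow> (Id C W \<boxdot>\<^bsub>C\<^esub> Assoc C X Y Z) \<cdot>\<^bsub>C\<^esub> Assoc C W (X \<boxtimes>\<^bsub>C\<^esub> Y) Z
              \<cdot>\<^bsub>C\<^esub> (Assoc C W X Y \<boxdot>\<^bsub>C\<^esub> Id C Z) =
            Assoc C W X (Y \<boxtimes>\<^bsub>C\<^esub> Z) \<cdot>\<^bsub>C\<^esub> Assoc C (W \<boxtimes>\<^bsub>C\<^esub> X) Y Z"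
    and triangle:
      "\<lbrakk>X \<in> Obj C; Y \<in> Obj C\<rbrakk>
        \<Longrightarrow> (Id C X \<boxdot>\<^bsub>C\<^esub> LUnit C Y) \<cdot>\<^bsub>C\<^esub> Assoc C X (UnitObj C) Y =
            RUnit C X \<boxdot>\<^bsub>C\<^esub> Id C Y"

text \<open>
  \<open>D\<close> is a left dual of \<open>X\<close>, with evaluation \<open>e : D \<boxtimes> X \<rightarrow> 1\<close> and coevaluation
  \<open>c : 1 \<rightarrow> X \<boxtimes> D\<close>. Equivalently, \<open>X\<close> is a right dual of \<open>D\<close>.
\<close>

definition is_left_dual ::
  "('k, 'o, 'm, 'z) monoidal_cat_scheme \<Rightarrow> 'o \<Rightarrow> 'o \<Rightarrow> 'm \<Rightarrow> 'm \<Rightarrow> bool" where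
  "is_left_dual C X D e c \<longleftrightarrow> X \<in> Obj C \<and> D \<in> Obj C \<and>
     e \<in> arr C (D \<boxtimes>\<^bsub>C\<^esub> X) (UnitObj C) \<and> c \<in> arr C (UnitObj C) (X \<boxtimes>\<^bsub>C\<^esub> D) \<and>
     RUnit C X \<cdot>\<^bsub>C\<^esub> (Id C X \<boxdot>\<^bsub>C\<^esub> e) \<cdot>\<^bsub>C\<^esub> Assoc C X D X \<cdot>\<^bsub>C\<^esub> (c \<boxdot>\<^bsub>C\<^esub> Id C X)
       \<cdot>\<^bsub>C\<^esub> inverse_arr C (UnitObj C \<boxtimes>\<^bsub>C\<^esub> X) X (LUnit C X) = Id C X \<and>
     LUnit C D \<cdot>\<^bsub>C\<^esub> (e \<boxdot>\<^bsub>C\<^esub> Id C D)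
       \<cdot>\<^bsub>C\<^esub> inverse_arr C ((D \<boxtimes>\<^bsub>C\<^esub> X) \<boxtimes>\<^bsub>C\<^esub> D) (D \<boxtimes>\<^bsub>C\<^esub> (X \<boxtimes>\<^bsub>C\<^esub> D)) (Assoc C D X D)
       \<cdot>\<^bsub>C\<^esub> (Id C D \<boxdot>\<^bsub>C\<^esub> c)
       \<cdot>\<^bsub>C\<^esub> inverse_arr C (D \<boxtimes>\<^bsub>C\<^esub> UnitObj C) D (RUnit C D) = Id C D"

record ('k, 'o, 'm) rigid_cat = "('k, 'o, 'm) monoidal_cat" +
  Dual :: "'o \<Rightarrow> 'o"
  Ev :: "'o \<Rightarrow> 'm"
  Coev :: "'o \<Rightarrow> 'm"

locale rigid_tensor_category = abelian_linear_category K C + monoidal_linear_category K C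
  for K :: "('k, 'r) ring_scheme" and C :: "('k, 'o, 'm, 'z) rigid_cat_scheme" +
  assumes Hom_fin_dim:
      "\<lbrakk>X \<in> Obj C; Y \<in> Obj C\<rbrakk> \<Longrightarrow> vectorspace.fin_dim K (Hom C X Y)"
    and finite_length: "X \<in> Obj C \<Longrightarrow> finite_length C X"
    and End_UnitObj:
      "bij_betw (\<lambda>a. a \<odot>\<^bsub>Hom C (UnitObj C) (UnitObj C)\<^esub> Id C (UnitObj C))
         (carrier K) (arr C (UnitObj C) (UnitObj C))"
    and left_dual: "X \<in> Obj C \<Longrightarrow> is_left_dual C X (Dual C X) (Ev C X) (Coev C X)"
    and right_dual: "X \<in> Obj C \<Longrightarrow> \<exists>D e c. is_left_dual C D X e c"

text \<open>
  The endomorphism \<open>1 \<rightarrow> W \<boxtimes> W* \<rightarrow> W** \<boxtimes> W* \<rightarrow> 1\<close>, read as an element of \<open>K\<close> through the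
  identification of \<open>K\<close> with the endomorphisms of the unit object.
\<close>

definition quantum_dim ::
  "('k, 'r) ring_scheme \<Rightarrow> ('k, 'o, 'm, 'z) rigid_cat_scheme \<Rightarrow> 'o \<Rightarrow> 'm \<Rightarrow> 'k" where
  "quantum_dim K C W i =
     (THE a. a \<in> carrier K \<and>
        a \<odot>\<^bsub>Hom C (UnitObj C) (UnitObj C)\<^esub> Id C (UnitObj C) =
          Ev C (Dual C W) \<cdot>\<^bsub>C\<^esub> (i \<boxdot>\<^bsub>C\<^esub> Id C (Dual C W)) \<cdot>\<^bsub>C\<^esub> Coev C W)"

end

theory Submission
  imports Defs
begin

text \<open>
  In an object of finite length, semisimplicity means that every subobject splits off. Let
  \<open>f : X \<rightarrow> V\<close> be monic. Since \<open>W\<close> is a left dual of some object, tensoring with \<open>W\<close> is a right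
  adjoint, so \<open>f \<otimes> W\<close> is monic, and it has a retraction \<open>r\<close> because \<open>V \<otimes> W\<close> is semisimple. The partial
  trace of \<open>r\<close> over \<open>W\<close>, formed with \<open>i\<close>, is a map \<open>t : V \<rightarrow> X\<close>, and by naturality \<open>t \<circ> f\<close> is the
  partial trace of the identity of \<open>X \<otimes> W\<close>, i.e. the invertible scalar \<open>dim\<^sub>i(W)\<close>.
\<close>

section \<open>Linear categories\<close>

text \<open>\<open>W\<close> enters through two dualities. That tensoring with \<open>W\<close>
  preserves monics comes from an object \<open>D\<close> whose left dual is \<open>W\<close>, with a
  genuine zigzag identity. The trace uses the coevaluation of \<open>W\<close> and the evaluation of
  \<open>Dual C W\<close>, the latter pulled back along \<open>i\<close> to a map from
  \<open>W \<otimes> Dual C W\<close> to the unit object. No zigzag identity links these two maps;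
  what is known is that their composite is the scalar dim_i(W). This suffices, since closing up the
  strand of \<open>W\<close> uses only naturality in the other factor. Closing it up is what brings
  back a map from \<open>V\<close> to \<open>X\<close>: a retraction of \<open>f \<otimes> W\<close>
  is an arbitrary morphism and need not be a morphism tensored with \<open>W\<close>. Splitting in
  the semisimple object \<open>V \<otimes> W\<close> is an induction over its simple summands. The
  way back to semisimplicity of \<open>V\<close> climbs a composition series, which is where finite
  length enters.\<close>

context linear_category
begin

abbreviation comp (infixl \<open>\<bullet>\<close> 70) where
  "g \<bullet> f \<equiv> g \<cdot>\<^bsub>C\<^esub> f"

text \<open>
  Typing judgements carry the objects along, so that typing rules are syntax-directed.
\<close>

definition hom :: "'m \<Rightarrow> 'o \<Rightarrow> 'o \<Rightarrow> bool" (\<open>\<guillemotleft>_ : _ \<rightarrow> _\<guillemotright>\<close>) where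
  "\<guillemotleft>f : X \<rightarrow> Y\<guillemotright> \<longleftrightarrow> X \<in> Obj C \<and> Y \<in> Obj C \<and> f \<in> arr C X Y"

lemma hom_Id: "X \<in> Obj C \<Longrightarrow> \<guillemotleft>Id C X : X \<rightarrow> X\<guillemotright>"
  by (simp add: hom_def Id_closed)

lemma hom_comp: "\<guillemotleft>g : Y \<rightarrow> Z\<guillemotright> \<Longrightarrow> \<guillemotleft>f : X \<rightarrow> Y\<guillemotright> \<Longrightarrow> \<guillemotleft>g \<bullet> f : X \<rightarrow> Z\<guillemotright>"
  by (auto simp: hom_def intro: Comp_closed)

lemma comp_Id_left: "\<guillemotleft>f : X \<rightarrow> Y\<guillemotright> \<Longrightarrow> Id C Y \<bullet> f = f"
  by (auto simp: hom_def Comp_Id_left)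

lemma comp_Id_right: "\<guillemotleft>f : X \<rightarrow> Y\<guillemotright> \<Longrightarrow> f \<bullet> Id C X = f"
  by (auto simp: hom_def Comp_Id_right)

lemma comp_assoc:
  "\<guillemotleft>h : Z \<rightarrow> W\<guillemotright> \<Longrightarrow> \<guillemotleft>g : Y \<rightarrow> Z\<guillemotright> \<Longrightarrow> \<guillemotleft>f : X \<rightarrow> Y\<guillemotright> \<Longrightarrow> h \<bullet> g \<bullet> f = h \<bullet> (g \<bullet> f)"
  unfolding hom_def by (metis Comp_assoc)

text \<open>Pasting of commuting squares. Naturality of \<open>unit_map\<close> and of
  \<open>counit_map\<close> is assembled from three squares each, so the reassociation is done once
  here.\<close>

lemma square_comp:
  assumes "\<guillemotleft>p : A \<rightarrow> B\<guillemotright>" "\<guillemotleft>q : B \<rightarrow> D\<guillemotright>" "\<guillemotleft>p' : A' \<rightarrow> B'\<guillemotright>" "\<guillemotleft>q' : B' \<rightarrow> D'\<guillemotright>"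
    and "\<guillemotleft>u : A \<rightarrow> A'\<guillemotright>" "\<guillemotleft>v : B \<rightarrow> B'\<guillemotright>" "\<guillemotleft>w : D \<rightarrow> D'\<guillemotright>"
    and "p' \<bullet> u = v \<bullet> p" "q' \<bullet> v = w \<bullet> q"
  shows "(q' \<bullet> p') \<bullet> u = w \<bullet> (q \<bullet> p)"
  using comp_assoc[OF assms(4,3,5)] comp_assoc[OF assms(4,6,1)] comp_assoc[OF assms(7,2,1)]
  by (simp add: assms(8,9))

text \<open>\<open>inverse_arr\<close> is a definite description, so its properties rest on
  uniqueness of two-sided inverses: h = h (f g) = (h f) g = g.\<close>

lemma isomorphismE:
  assumes "isomorphism C X Y f"
  shows "\<guillemotleft>f : X \<rightarrow> Y\<guillemotright>" and "\<guillemotleft>inverse_arr C X Y f : Y \<rightarrow> X\<guillemotright>"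
    and "inverse_arr C X Y f \<bullet> f = Id C X" and "f \<bullet> inverse_arr C X Y f = Id C Y"
proof -
  let ?P = "\<lambda>g. g \<in> arr C Y X \<and> g \<bullet> f = Id C X \<and> f \<bullet> g = Id C Y"
  show f: "\<guillemotleft>f : X \<rightarrow> Y\<guillemotright>"
    using assms by (auto simp: isomorphism_def hom_def)
  obtain g where g: "?P g"
    using assms by (auto simp: isomorphism_def)
  have "h = g" if h: "?P h" for h
  proof -
    have "\<guillemotleft>g : Y \<rightarrow> X\<guillemotright>" "\<guillemotleft>h : Y \<rightarrow> X\<guillemotright>"
      using f g h by (auto simp: hom_def)
    then show ?thesis
      using comp_assoc[of h Y X f X g Y] f g h by (metis comp_Id_left comp_Id_right)
  qed
  then have "?P (inverse_arr C X Y f)"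
    unfolding inverse_arr_def using g theI[of ?P g] by blast
  then show "\<guillemotleft>inverse_arr C X Y f : Y \<rightarrow> X\<guillemotright>"
    "inverse_arr C X Y f \<bullet> f = Id C X" "f \<bullet> inverse_arr C X Y f = Id C Y"
    using f by (auto simp: hom_def)
qed

text \<open>The axioms give naturality of the constraints but not of their inverses. Inserting
  \<open>a\<close> and its inverse to the right of \<open>v\<close> brings the given square into
  play, after which \<open>b\<close> cancels.\<close>

lemma inverse_natural:
  assumes a: "isomorphism C X X' a" and b: "isomorphism C Y Y' b"
    and u: "\<guillemotleft>u : X \<rightarrow> Y\<guillemotright>" and v: "\<guillemotleft>v : X' \<rightarrow> Y'\<guillemotright>" and sq: "b \<bullet> u = v \<bullet> a"
  shows "inverse_arr C Y Y' b \<bullet> v = u \<bullet> inverse_arr C X X' a"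
proof -
  note A = isomorphismE[OF a] and B = isomorphismE[OF b]
  let ?a = "inverse_arr C X X' a" and ?b = "inverse_arr C Y Y' b"
  have "?b \<bullet> v = ?b \<bullet> (v \<bullet> a \<bullet> ?a)"
    using comp_assoc[OF v A(1,2)] by (simp add: A(4) comp_Id_right[OF v])
  also have "\<dots> = ?b \<bullet> (b \<bullet> u \<bullet> ?a)"
    by (simp add: sq)
  also have "\<dots> = u \<bullet> ?a"
    using comp_assoc[OF B(1) u A(2)] comp_assoc[OF B(2,1) hom_comp[OF u A(2)]]
    by (simp add: B(3) comp_Id_left[OF hom_comp[OF u A(2)]])
  finally show ?thesis .
qed

lemma isomorphism_left_cancel:
  assumes a: "isomorphism C X Y a" and f: "\<guillemotleft>f : Z \<rightarrow> X\<guillemotright>" and g: "\<guillemotleft>g : Z \<rightarrow> X\<guillemotright>"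
    and eq: "a \<bullet> f = a \<bullet> g"
  shows "f = g"
proof -
  note A = isomorphismE[OF a]
  show ?thesis
    using arg_cong[OF eq, of "\<lambda>h. inverse_arr C X Y a \<bullet> h"]
      comp_assoc[OF A(2,1) f] comp_assoc[OF A(2,1) g]
    by (simp add: A(3) comp_Id_left[OF f] comp_Id_left[OF g])
qed

lemma isomorphism_inverse:
  assumes a: "isomorphism C X Y a"
  shows "isomorphism C Y X (inverse_arr C X Y a)"
  using isomorphismE[OF a] unfolding isomorphism_def hom_def by blast

lemma isomorphism_comp:
  assumes a: "isomorphism C X Y a" and b: "isomorphism C Y Z b"
  shows "isomorphism C X Z (b \<bullet> a)"
proof -
  note A = isomorphismE[OF a] and B = isomorphismE[OF b]
  let ?a = "inverse_arr C X Y a" and ?b = "inverse_arr C Y Z b"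
  have "?a \<bullet> ?b \<bullet> (b \<bullet> a) = Id C X"
    using comp_assoc[OF A(2) B(2) hom_comp[OF B(1) A(1)]] comp_assoc[OF B(2,1) A(1)] A(3) B(3)
    by (simp add: comp_Id_left[OF A(1)])
  moreover have "b \<bullet> a \<bullet> (?a \<bullet> ?b) = Id C Z"
    using comp_assoc[OF B(1) A(1) hom_comp[OF A(2) B(2)]] comp_assoc[OF A(1,2) B(2)] A(4) B(4)
    by (simp add: comp_Id_left[OF B(2)])
  ultimately show ?thesis
    using hom_comp[OF B(1) A(1)] hom_comp[OF A(2) B(2)]
    unfolding isomorphism_def hom_def by blast
qed

section \<open>Additive structure of the Hom spaces\<close>

lemma Hom_module: "X \<in> Obj C \<Longrightarrow> Y \<in> Obj C \<Longrightarrow> module K (Hom C X Y)"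
  using Hom_vectorspace by (simp add: vectorspace_def)

lemma Hom_abelian_group: "X \<in> Obj C \<Longrightarrow> Y \<in> Obj C \<Longrightarrow> abelian_group (Hom C X Y)"
  using Hom_module by (simp add: module_def)

lemma Hom_abelian_monoid: "X \<in> Obj C \<Longrightarrow> Y \<in> Obj C \<Longrightarrow> abelian_monoid (Hom C X Y)"
  using Hom_abelian_group by (simp add: abelian_group_def)

lemma hom_zero: "X \<in> Obj C \<Longrightarrow> Y \<in> Obj C \<Longrightarrow> \<guillemotleft>\<zero>\<^bsub>Hom C X Y\<^esub> : X \<rightarrow> Y\<guillemotright>"
  by (simp add: hom_def abelian_monoid.zero_closed Hom_abelian_monoid)

lemma hom_smult: "a \<in> carrier K \<Longrightarrow> \<guillemotleft>f : X \<rightarrow> Y\<guillemotright> \<Longrightarrow> \<guillemotleft>a \<odot>\<^bsub>Hom C X Y\<^esub> f : X \<rightarrow> Y\<guillemotright>"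
  by (simp add: hom_def module.smult_closed[OF Hom_module])

lemma hom_diff: "\<guillemotleft>f : X \<rightarrow> Y\<guillemotright> \<Longrightarrow> \<guillemotleft>g : X \<rightarrow> Y\<guillemotright> \<Longrightarrow> \<guillemotleft>f \<ominus>\<^bsub>Hom C X Y\<^esub> g : X \<rightarrow> Y\<guillemotright>"
  by (simp add: hom_def abelian_group.minus_closed Hom_abelian_group)

lemma hom_finsum:
  assumes "X \<in> Obj C" "Y \<in> Obj C" "\<And>i. i < n \<Longrightarrow> \<guillemotleft>f i : X \<rightarrow> Y\<guillemotright>"
  shows "\<guillemotleft>\<Oplus>\<^bsub>Hom C X Y\<^esub> i \<in> {..<n::nat}. f i : X \<rightarrow> Y\<guillemotright>"
  using assms by (auto simp: hom_def intro!: abelian_monoid.finsum_closed Hom_abelian_monoid)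

lemma zero_smult: "\<guillemotleft>f : X \<rightarrow> Y\<guillemotright> \<Longrightarrow> \<zero>\<^bsub>K\<^esub> \<odot>\<^bsub>Hom C X Y\<^esub> f = \<zero>\<^bsub>Hom C X Y\<^esub>"
  by (simp add: hom_def module.smult_l_null[OF Hom_module])

text \<open>The axioms speak of sums and scalar multiples of morphisms; zero is reached by writing
  it as the scalar zero times itself.\<close>

lemma comp_zero_right:
  assumes g: "\<guillemotleft>g : Y \<rightarrow> Z\<guillemotright>" and X: "X \<in> Obj C"
  shows "g \<bullet> \<zero>\<^bsub>Hom C X Y\<^esub> = \<zero>\<^bsub>Hom C X Z\<^esub>"
proof -
  have 0: "\<guillemotleft>\<zero>\<^bsub>Hom C X Y\<^esub> : X \<rightarrow> Y\<guillemotright>"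
    using g X by (intro hom_zero) (simp_all add: hom_def)
  show ?thesis
    using Comp_smult_right[of X Y Z "\<zero>\<^bsub>K\<^esub>" "\<zero>\<^bsub>Hom C X Y\<^esub>" g] zero_smult[OF 0]
      zero_smult[OF hom_comp[OF g 0]] g 0 by (simp add: hom_def)
qed

lemma comp_zero_left:
  assumes f: "\<guillemotleft>f : X \<rightarrow> Y\<guillemotright>" and Z: "Z \<in> Obj C"
  shows "\<zero>\<^bsub>Hom C Y Z\<^esub> \<bullet> f = \<zero>\<^bsub>Hom C X Z\<^esub>"
proof -
  have 0: "\<guillemotleft>\<zero>\<^bsub>Hom C Y Z\<^esub> : Y \<rightarrow> Z\<guillemotright>"
    using f Z by (intro hom_zero) (simp_all add: hom_def)
  show ?thesis
    using Comp_smult_left[of X Y Z "\<zero>\<^bsub>K\<^esub>" f "\<zero>\<^bsub>Hom C Y Z\<^esub>"] zero_smult[OF 0]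
      zero_smult[OF hom_comp[OF 0 f]] f 0 by (simp add: hom_def)
qed

text \<open>With the scalar -1, compatibility of composition with differences reduces to the axioms
  on sums and scalar multiples.\<close>

lemma diff_conv_smult:
  assumes "\<guillemotleft>f : X \<rightarrow> Y\<guillemotright>" "\<guillemotleft>g : X \<rightarrow> Y\<guillemotright>"
  shows "f \<ominus>\<^bsub>Hom C X Y\<^esub> g = f \<oplus>\<^bsub>Hom C X Y\<^esub> (\<ominus>\<^bsub>K\<^esub> \<one>\<^bsub>K\<^esub>) \<odot>\<^bsub>Hom C X Y\<^esub> g"
  using assms module.smult_l_minus[OF Hom_module, of X Y "\<one>\<^bsub>K\<^esub>" g]
    module.smult_one[OF Hom_module, of X Y g] by (simp add: hom_def a_minus_def)

lemma comp_diff_left: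
  assumes f: "\<guillemotleft>f : X \<rightarrow> Y\<guillemotright>" and g: "\<guillemotleft>g : Y \<rightarrow> Z\<guillemotright>" and h: "\<guillemotleft>h : Y \<rightarrow> Z\<guillemotright>"
  shows "(g \<ominus>\<^bsub>Hom C Y Z\<^esub> h) \<bullet> f = (g \<bullet> f) \<ominus>\<^bsub>Hom C X Z\<^esub> (h \<bullet> f)"
  using assms hom_smult[OF _ h, of "\<ominus>\<^bsub>K\<^esub> \<one>\<^bsub>K\<^esub>"]
  by (simp add: diff_conv_smult[OF g h] diff_conv_smult[OF hom_comp[OF g f] hom_comp[OF h f]]
      hom_def Comp_add_left[of X Y Z] Comp_smult_left[of X Y Z])

lemma comp_diff_right:
  assumes h: "\<guillemotleft>h : Y \<rightarrow> Z\<guillemotright>" and f: "\<guillemotleft>f : X \<rightarrow> Y\<guillemotright>" and g: "\<guillemotleft>g : X \<rightarrow> Y\<guillemotright>"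
  shows "h \<bullet> (f \<ominus>\<^bsub>Hom C X Y\<^esub> g) = (h \<bullet> f) \<ominus>\<^bsub>Hom C X Z\<^esub> (h \<bullet> g)"
  using assms hom_smult[OF _ g, of "\<ominus>\<^bsub>K\<^esub> \<one>\<^bsub>K\<^esub>"]
  by (simp add: diff_conv_smult[OF f g] diff_conv_smult[OF hom_comp[OF h f] hom_comp[OF h g]]
      hom_def Comp_add_right[of X Y Z] Comp_smult_right[of X Y Z])

lemma diff_add_cancel:
  assumes "\<guillemotleft>f : X \<rightarrow> Y\<guillemotright>" "\<guillemotleft>g : X \<rightarrow> Y\<guillemotright>"
  shows "f \<ominus>\<^bsub>Hom C X Y\<^esub> g \<oplus>\<^bsub>Hom C X Y\<^esub> g = f"
  using assms Hom_abelian_group[of X Y]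
  by (simp add: hom_def a_minus_def abelian_group.l_neg abelian_group.a_inv_closed
      abelian_monoid.a_assoc abelian_group.axioms(1) abelian_monoid.r_zero)

lemma diff_eq_zero_iff:
  assumes "\<guillemotleft>f : X \<rightarrow> Y\<guillemotright>" "\<guillemotleft>g : X \<rightarrow> Y\<guillemotright>"
  shows "f \<ominus>\<^bsub>Hom C X Y\<^esub> g = \<zero>\<^bsub>Hom C X Y\<^esub> \<longleftrightarrow> f = g"
  using assms Hom_abelian_group[of X Y] diff_add_cancel[OF assms]
  by (auto simp: hom_def a_minus_def abelian_group.r_neg abelian_monoid.l_zero
      abelian_group.axioms(1))

lemma diff_zero_right:
  assumes "\<guillemotleft>f : X \<rightarrow> Y\<guillemotright>"
  shows "f \<ominus>\<^bsub>Hom C X Y\<^esub> \<zero>\<^bsub>Hom C X Y\<^esub> = f"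
  using assms hom_zero[of X Y] hom_diff[OF assms, of "\<zero>\<^bsub>Hom C X Y\<^esub>"]
    diff_add_cancel[OF assms, of "\<zero>\<^bsub>Hom C X Y\<^esub>"]
  by (simp add: hom_def abelian_monoid.r_zero Hom_abelian_monoid)

lemma comp_finsum_right:
  assumes h: "\<guillemotleft>h : Y \<rightarrow> Z\<guillemotright>" and X: "X \<in> Obj C" and f: "\<And>i. i < n \<Longrightarrow> \<guillemotleft>f i : X \<rightarrow> Y\<guillemotright>"
  shows "h \<bullet> (\<Oplus>\<^bsub>Hom C X Y\<^esub> i \<in> {..<n::nat}. f i) = (\<Oplus>\<^bsub>Hom C X Z\<^esub> i \<in> {..<n}. h \<bullet> f i)"
  using f
proof (induction n)
  case 0
  have "X \<in> Obj C" "Y \<in> Obj C" "Z \<in> Obj C"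
    using h X by (auto simp: hom_def)
  then show ?case
    using comp_zero_right[OF h X] by (simp add: abelian_monoid.finsum_empty Hom_abelian_monoid)
next
  case (Suc n)
  have Y: "Y \<in> Obj C" and Z: "Z \<in> Obj C"
    using h by (auto simp: hom_def)
  have fn: "\<guillemotleft>\<Oplus>\<^bsub>Hom C X Y\<^esub> i \<in> {..<n}. f i : X \<rightarrow> Y\<guillemotright>"
    by (intro hom_finsum X Y Suc.prems) simp
  have hf: "\<guillemotleft>h \<bullet> f i : X \<rightarrow> Z\<guillemotright>" if "i < Suc n" for i
    using hom_comp[OF h Suc.prems[OF that]] .
  show ?case
    using Suc.IH Suc.prems fn h hf X Y Z unfolding lessThan_Suc
    by (subst (1 2) abelian_monoid.finsum_insert)
      (auto simp: hom_def Hom_abelian_monoid Comp_add_right)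
qed

lemma comp_finsum_left:
  assumes h: "\<guillemotleft>h : X \<rightarrow> Y\<guillemotright>" and Z: "Z \<in> Obj C" and f: "\<And>i. i < n \<Longrightarrow> \<guillemotleft>f i : Y \<rightarrow> Z\<guillemotright>"
  shows "(\<Oplus>\<^bsub>Hom C Y Z\<^esub> i \<in> {..<n::nat}. f i) \<bullet> h = (\<Oplus>\<^bsub>Hom C X Z\<^esub> i \<in> {..<n}. f i \<bullet> h)"
  using f
proof (induction n)
  case 0
  have "X \<in> Obj C" "Y \<in> Obj C" "Z \<in> Obj C"
    using h Z by (auto simp: hom_def)
  then show ?case
    using comp_zero_left[OF h Z] by (simp add: abelian_monoid.finsum_empty Hom_abelian_monoid)
next
  case (Suc n)
  have X: "X \<in> Obj C" and Y: "Y \<in> Obj C"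
    using h by (auto simp: hom_def)
  have fn: "\<guillemotleft>\<Oplus>\<^bsub>Hom C Y Z\<^esub> i \<in> {..<n}. f i : Y \<rightarrow> Z\<guillemotright>"
    by (intro hom_finsum Z Y Suc.prems) simp
  have hf: "\<guillemotleft>f i \<bullet> h : X \<rightarrow> Z\<guillemotright>" if "i < Suc n" for i
    using hom_comp[OF Suc.prems[OF that] h] .
  show ?case
    using Suc.IH Suc.prems fn h hf X Y Z unfolding lessThan_Suc
    by (subst (1 2) abelian_monoid.finsum_insert)
      (auto simp: hom_def Hom_abelian_monoid Comp_add_left)
qed

lemma finsum_Suc_Hom:
  assumes "X \<in> Obj C" "Y \<in> Obj C" "\<And>i. i < Suc n \<Longrightarrow> \<guillemotleft>f i : X \<rightarrow> Y\<guillemotright>"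
  shows "(\<Oplus>\<^bsub>Hom C X Y\<^esub> i \<in> {..<Suc n}. f i) =
    f n \<oplus>\<^bsub>Hom C X Y\<^esub> (\<Oplus>\<^bsub>Hom C X Y\<^esub> i \<in> {..<n}. f i)"
  using assms unfolding lessThan_Suc
  by (subst abelian_monoid.finsum_insert) (auto simp: hom_def Hom_abelian_monoid)


lemma finsum_Hom_cong:
  assumes "X \<in> Obj C" "Y \<in> Obj C" "\<And>i. i < n \<Longrightarrow> \<guillemotleft>g i : X \<rightarrow> Y\<guillemotright>"
    and "\<And>i. i < (n::nat) \<Longrightarrow> f i = g i"
  shows "(\<Oplus>\<^bsub>Hom C X Y\<^esub> i \<in> {..<n}. f i) = (\<Oplus>\<^bsub>Hom C X Y\<^esub> i \<in> {..<n}. g i)"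
  using assms by (intro abelian_monoid.finsum_cong' Hom_abelian_monoid) (auto simp: hom_def)

section \<open>Monics, kernels and cokernels\<close>

lemma monic_zero:
  assumes f: "monic C X Y f" and z: "\<guillemotleft>z : Z \<rightarrow> X\<guillemotright>" and 0: "f \<bullet> z = \<zero>\<^bsub>Hom C Z Y\<^esub>"
  shows "z = \<zero>\<^bsub>Hom C Z X\<^esub>"
proof -
  have "\<guillemotleft>f : X \<rightarrow> Y\<guillemotright>" "Z \<in> Obj C" "X \<in> Obj C"
    using f z by (auto simp: monic_def hom_def)
  then have "f \<bullet> z = f \<bullet> \<zero>\<^bsub>Hom C Z X\<^esub>" and "\<zero>\<^bsub>Hom C Z X\<^esub> \<in> arr C Z X"
    using 0 comp_zero_right[of f X Y Z] hom_zero[of Z X] by (auto simp: hom_def)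
  then show ?thesis
    using f z by (auto simp: monic_def hom_def)
qed

lemma monic_comp:
  assumes f: "monic C X Y f" and g: "monic C Y Z g"
  shows "monic C X Z (g \<bullet> f)"
proof -
  have fh: "\<guillemotleft>f : X \<rightarrow> Y\<guillemotright>" and gh: "\<guillemotleft>g : Y \<rightarrow> Z\<guillemotright>"
    using f g by (auto simp: monic_def hom_def)
  have "u = v" if "T \<in> Obj C" "u \<in> arr C T X" "v \<in> arr C T X" "g \<bullet> f \<bullet> u = g \<bullet> f \<bullet> v" for T u v
  proof -
    have u: "\<guillemotleft>u : T \<rightarrow> X\<guillemotright>" and v: "\<guillemotleft>v : T \<rightarrow> X\<guillemotright>"
      using that fh by (auto simp: hom_def)
    have "g \<bullet> (f \<bullet> u) = g \<bullet> (f \<bullet> v)"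
      using that comp_assoc[OF gh fh u] comp_assoc[OF gh fh v] by simp
    then have "f \<bullet> u = f \<bullet> v"
      using g hom_comp[OF fh u] hom_comp[OF fh v] by (auto simp: monic_def hom_def)
    then show ?thesis
      using f that by (auto simp: monic_def)
  qed
  then show ?thesis
    using hom_comp[OF gh fh] by (auto simp: monic_def hom_def)
qed

lemma is_kernelE:
  assumes "is_kernel C X Y f N n" and X: "X \<in> Obj C"
  shows "\<guillemotleft>n : N \<rightarrow> X\<guillemotright>" and "f \<bullet> n = \<zero>\<^bsub>Hom C N Y\<^esub>"
    and "\<And>Z h. \<guillemotleft>h : Z \<rightarrow> X\<guillemotright> \<Longrightarrow> f \<bullet> h = \<zero>\<^bsub>Hom C Z Y\<^esub> \<Longrightarrow> \<exists>u. \<guillemotleft>u : Z \<rightarrow> N\<guillemotright> \<and> n \<bullet> u = h"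
  using assms unfolding is_kernel_def hom_def by blast+

lemma is_cokernelE:
  assumes "is_cokernel C X Y f Q q" and Y: "Y \<in> Obj C"
  shows "\<guillemotleft>q : Y \<rightarrow> Q\<guillemotright>" and "q \<bullet> f = \<zero>\<^bsub>Hom C X Q\<^esub>"
    and "\<And>Z h. \<guillemotleft>h : Y \<rightarrow> Z\<guillemotright> \<Longrightarrow> h \<bullet> f = \<zero>\<^bsub>Hom C X Z\<^esub> \<Longrightarrow> \<exists>u. \<guillemotleft>u : Q \<rightarrow> Z\<guillemotright> \<and> u \<bullet> q = h"
  using assms unfolding is_cokernel_def hom_def by blast+

text \<open>If \<open>n \<bullet> u = n \<bullet> v\<close>, this map is killed by \<open>f\<close>,
  so the universal property lets it factor through \<open>n\<close> in only one way. The argument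
  for cokernels is dual.\<close>

lemma is_kernel_monic:
  assumes k: "is_kernel C X Y f N n" and f: "\<guillemotleft>f : X \<rightarrow> Y\<guillemotright>"
  shows "monic C N X n"
proof -
  have X: "X \<in> Obj C" using f by (simp add: hom_def)
  note n = is_kernelE(1,2)[OF k X]
  have "u = v" if "Z \<in> Obj C" "u \<in> arr C Z N" "v \<in> arr C Z N" "n \<bullet> u = n \<bullet> v" for Z u v
  proof -
    have v: "\<guillemotleft>v : Z \<rightarrow> N\<guillemotright>" using that n by (auto simp: hom_def)
    have "f \<bullet> (n \<bullet> v) = \<zero>\<^bsub>Hom C Z Y\<^esub>"
      using comp_assoc[OF f n(1) v] n(2) comp_zero_left[OF v, of Y] f by (simp add: hom_def)
    then show ?thesis
      using k that hom_comp[OF n(1) v] unfolding is_kernel_def hom_def by metis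
  qed
  then show ?thesis
    using n by (auto simp: monic_def hom_def)
qed

lemma is_cokernel_epic:
  assumes k: "is_cokernel C X Y f Q q" and f: "\<guillemotleft>f : X \<rightarrow> Y\<guillemotright>"
  shows "epic C Y Q q"
proof -
  have Y: "Y \<in> Obj C" using f by (simp add: hom_def)
  note q = is_cokernelE(1,2)[OF k Y]
  have "u = v" if "Z \<in> Obj C" "u \<in> arr C Q Z" "v \<in> arr C Q Z" "u \<bullet> q = v \<bullet> q" for Z u v
  proof -
    have v: "\<guillemotleft>v : Q \<rightarrow> Z\<guillemotright>" using that q by (auto simp: hom_def)
    have "v \<bullet> q \<bullet> f = \<zero>\<^bsub>Hom C X Z\<^esub>"
      using comp_assoc[OF v q(1) f] q(2) comp_zero_right[OF v, of X] f by (simp add: hom_def)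
    then show ?thesis
      using k that hom_comp[OF v q(1)] unfolding is_cokernel_def hom_def by metis
  qed
  then show ?thesis
    using q by (auto simp: epic_def hom_def)
qed

end

section \<open>Semisimplicity by splitting of subobjects\<close>

context linear_category
begin

text \<open>Splitting is phrased by retractions rather than by complements, because a retraction is
  a single morphism that can be traced over \<open>W\<close>.\<close>

definition monics_split :: "'o \<Rightarrow> bool" where
  "monics_split X \<longleftrightarrow> (\<forall>U f. monic C U X f \<longrightarrow> (\<exists>r. \<guillemotleft>r : X \<rightarrow> U\<guillemotright> \<and> r \<bullet> f = Id C U))"

text \<open>If \<open>r\<close> retracts \<open>g \<bullet> f\<close>, then
  \<open>r \<bullet> g\<close> retracts \<open>f\<close>. This carries splitting down a composition
  series.\<close>

lemma monics_split_subobject: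
  assumes X: "monics_split X" and g: "monic C Y X g"
  shows "monics_split Y"
  unfolding monics_split_def
proof (intro allI impI)
  fix U f assume f: "monic C U Y f"
  then obtain r where r: "\<guillemotleft>r : X \<rightarrow> U\<guillemotright>" "r \<bullet> (g \<bullet> f) = Id C U"
    using X monic_comp[OF f g] unfolding monics_split_def by blast
  have "\<guillemotleft>f : U \<rightarrow> Y\<guillemotright>" "\<guillemotleft>g : Y \<rightarrow> X\<guillemotright>"
    using f g by (auto simp: monic_def hom_def)
  then show "\<exists>r. \<guillemotleft>r : Y \<rightarrow> U\<guillemotright> \<and> r \<bullet> f = Id C U"
    using r comp_assoc[of r X U g Y f U] hom_comp[of r X U g Y] by auto
qed

lemma zero_object_semisimple:
  assumes "zero_object C Z"
  shows "semisimple_object C Z"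
proof -
  have Z: "Z \<in> Obj C"
    using assms by (simp add: zero_object_def)
  then have "\<zero>\<^bsub>Hom C Z Z\<^esub> = Id C Z"
    using assms hom_zero[OF Z Z] hom_Id[OF Z] by (auto simp: zero_object_def hom_def)
  then have "is_direct_sum C 0 S Z \<iota> \<pi>" for S \<iota> \<pi>
    using Z by (simp add: is_direct_sum_def abelian_monoid.finsum_empty Hom_abelian_monoid)
  then show ?thesis
    unfolding semisimple_object_def by blast
qed

lemma is_direct_sumE:
  assumes "is_direct_sum C n S X \<iota> \<pi>"
  shows "X \<in> Obj C"
    and "\<And>i. i < n \<Longrightarrow> \<guillemotleft>\<iota> i : S i \<rightarrow> X\<guillemotright>" and "\<And>i. i < n \<Longrightarrow> \<guillemotleft>\<pi> i : X \<rightarrow> S i\<guillemotright>"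
    and "\<And>i j. i < n \<Longrightarrow> j < n \<Longrightarrow>
      \<pi> i \<bullet> \<iota> j = (if i = j then Id C (S i) else \<zero>\<^bsub>Hom C (S j) (S i)\<^esub>)"
    and "(\<Oplus>\<^bsub>Hom C X X\<^esub> i \<in> {..<n}. \<iota> i \<bullet> \<pi> i) = Id C X"
  using assms unfolding is_direct_sum_def hom_def by blast+

text \<open>The hypotheses exhibit \<open>G\<close> as the direct sum of \<open>F\<close> and
  \<open>Q\<close>, with inclusions \<open>f\<close>, \<open>s\<close> and projections
  \<open>r\<close>, \<open>q\<close>. The summands of \<open>F\<close> keep their indices and
  \<open>Q\<close> receives the new index \<open>n\<close>.\<close>

lemma is_direct_sum_extend:
  assumes F: "is_direct_sum C n S F \<iota> \<pi>"
    and f: "\<guillemotleft>f : F \<rightarrow> G\<guillemotright>" and r: "\<guillemotleft>r : G \<rightarrow> F\<guillemotright>" and s: "\<guillemotleft>s : Q \<rightarrow> G\<guillemotright>" and q: "\<guillemotleft>q : G \<rightarrow> Q\<guillemotright>"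
    and rf: "r \<bullet> f = Id C F" and qs: "q \<bullet> s = Id C Q"
    and qf: "q \<bullet> f = \<zero>\<^bsub>Hom C F Q\<^esub>" and rs: "r \<bullet> s = \<zero>\<^bsub>Hom C Q F\<^esub>"
    and sum: "s \<bullet> q \<oplus>\<^bsub>Hom C G G\<^esub> f \<bullet> r = Id C G"
  shows "is_direct_sum C (Suc n) (S(n := Q)) G ((\<lambda>i. f \<bullet> \<iota> i)(n := s)) ((\<lambda>i. \<pi> i \<bullet> r)(n := q))"
    (is "is_direct_sum C _ ?S G ?\<iota> ?\<pi>")
proof -
  note D = is_direct_sumE[OF F]
  have G: "G \<in> Obj C" and Q: "Q \<in> Obj C"
    using f q by (auto simp: hom_def)
  have \<iota>: "\<guillemotleft>?\<iota> i : ?S i \<rightarrow> G\<guillemotright>" and \<pi>: "\<guillemotleft>?\<pi> i : G \<rightarrow> ?S i\<guillemotright>" if "i < Suc n" for i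
    using that hom_comp[OF f D(2)[of i]] hom_comp[OF D(3)[of i] r] s q by auto
  have \<pi>\<iota>: "?\<pi> i \<bullet> ?\<iota> j = (if i = j then Id C (?S i) else \<zero>\<^bsub>Hom C (?S j) (?S i)\<^esub>)"
    if i: "i < Suc n" and j: "j < Suc n" for i j
  proof -
    have 1: "\<pi> i \<bullet> r \<bullet> (f \<bullet> \<iota> j) = \<pi> i \<bullet> \<iota> j" if "i < n" "j < n"
      using that comp_assoc[OF D(3) r hom_comp[OF f D(2)], of i j] comp_assoc[OF r f D(2), of j] rf
      by (simp add: comp_Id_left[OF D(2)])
    have 2: "\<pi> i \<bullet> r \<bullet> s = \<zero>\<^bsub>Hom C Q (S i)\<^esub>" if "i < n"
      using that comp_assoc[OF D(3) r s, of i] comp_zero_right[OF D(3) Q, of i] rs by simp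
    have 3: "q \<bullet> (f \<bullet> \<iota> j) = \<zero>\<^bsub>Hom C (S j) Q\<^esub>" if "j < n"
      using that comp_assoc[OF q f D(2), of j] comp_zero_left[OF D(2) Q, of j] qf by simp
    show ?thesis
      using i j 1 2 3 qs D(4)[of i j] by (auto simp: less_Suc_eq)
  qed
  have "(\<Oplus>\<^bsub>Hom C G G\<^esub> i \<in> {..<n}. ?\<iota> i \<bullet> ?\<pi> i) =
      (\<Oplus>\<^bsub>Hom C G G\<^esub> i \<in> {..<n}. f \<bullet> (\<iota> i \<bullet> \<pi> i \<bullet> r))"
  proof (rule finsum_Hom_cong[OF G G])
    fix i assume i: "i < n"
    show "\<guillemotleft>f \<bullet> (\<iota> i \<bullet> \<pi> i \<bullet> r) : G \<rightarrow> G\<guillemotright>"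
      by (rule hom_comp f r D(2,3) i)+
    show "?\<iota> i \<bullet> ?\<pi> i = f \<bullet> (\<iota> i \<bullet> \<pi> i \<bullet> r)"
      using i comp_assoc[OF f D(2)[OF i] hom_comp[OF D(3)[OF i] r]]
        comp_assoc[OF D(2)[OF i] D(3)[OF i] r] by simp
  qed
  also have "\<dots> = f \<bullet> ((\<Oplus>\<^bsub>Hom C F F\<^esub> i \<in> {..<n}. \<iota> i \<bullet> \<pi> i) \<bullet> r)"
    using comp_finsum_left[OF r D(1), of n "\<lambda>i. \<iota> i \<bullet> \<pi> i", OF hom_comp[OF D(2,3)]]
      comp_finsum_right[OF f G, of n "\<lambda>i. \<iota> i \<bullet> \<pi> i \<bullet> r", OF hom_comp[OF hom_comp[OF D(2,3)] r]] by simp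
  also have "\<dots> = f \<bullet> r"
    using D(5) comp_Id_left[OF r] by simp
  finally have "(\<Oplus>\<^bsub>Hom C G G\<^esub> i \<in> {..<Suc n}. ?\<iota> i \<bullet> ?\<pi> i) = Id C G"
    using sum finsum_Suc_Hom[of G G n "\<lambda>i. ?\<iota> i \<bullet> ?\<pi> i", OF G G hom_comp[OF \<iota> \<pi>]] by simp
  then show ?thesis
    using G \<iota> \<pi> \<pi>\<iota> unfolding is_direct_sum_def hom_def by blast
qed

text \<open>The sequence from \<open>F\<close> through \<open>G\<close> to \<open>Q\<close> splits.
  A retraction \<open>r\<close> of \<open>f\<close> gives the endomorphism \<open>1 - f r\<close> of
  \<open>G\<close>; it kills \<open>f\<close>, so it factors through the cokernel as
  \<open>s \<bullet> q\<close>, and this \<open>s\<close> includes \<open>Q\<close> as a complement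
  of \<open>F\<close>.\<close>

lemma semisimple_extension:
  assumes F: "semisimple_object C F" and f: "monic C F G f" and G: "monics_split G"
    and q: "is_cokernel C F G f Q q" and Q: "simple_object C Q"
  shows "semisimple_object C G"
proof -
  have fh: "\<guillemotleft>f : F \<rightarrow> G\<guillemotright>"
    using f by (auto simp: monic_def hom_def)
  then have F': "F \<in> Obj C" and G': "G \<in> Obj C"
    by (auto simp: hom_def)
  note qc = is_cokernelE[OF q G']
  have qe: "epic C G Q q"
    by (rule is_cokernel_epic[OF q fh])
  obtain r where r: "\<guillemotleft>r : G \<rightarrow> F\<guillemotright>" "r \<bullet> f = Id C F"
    using G f unfolding monics_split_def by blast
  have Q': "Q \<in> Obj C"
    using Q by (simp add: simple_object_def)
  have I: "\<guillemotleft>Id C G : G \<rightarrow> G\<guillemotright>" and fr: "\<guillemotleft>f \<bullet> r : G \<rightarrow> G\<guillemotright>"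
    using G' hom_Id hom_comp[OF fh r(1)] by auto
  have d: "\<guillemotleft>Id C G \<ominus>\<^bsub>Hom C G G\<^esub> f \<bullet> r : G \<rightarrow> G\<guillemotright>" (is "\<guillemotleft>?d : _ \<rightarrow> _\<guillemotright>")
    by (rule hom_diff[OF I fr])
  have "?d \<bullet> f = \<zero>\<^bsub>Hom C F G\<^esub>"
    using comp_diff_left[OF fh I fr] comp_assoc[OF fh r(1) fh] r(2) comp_Id_left[OF fh]
      comp_Id_right[OF fh] diff_eq_zero_iff[OF fh fh] by simp
  then obtain s where s: "\<guillemotleft>s : Q \<rightarrow> G\<guillemotright>" "s \<bullet> q = ?d"
    using qc(3)[OF d] by blast
  have qfr: "q \<bullet> (f \<bullet> r) = \<zero>\<^bsub>Hom C G Q\<^esub>"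
    using comp_assoc[OF qc(1) fh r(1)] qc(2) comp_zero_left[OF r(1) Q'] by simp
  \<comment> \<open>Since \<open>q\<close> is epic, identities about \<open>s\<close> may be checked
    after composing with \<open>q\<close> on the right, where \<open>s \<bullet> q\<close> becomes
    \<open>1 - f r\<close>.\<close>
  have "q \<bullet> s \<bullet> q = Id C Q \<bullet> q"
    using comp_assoc[OF qc(1) s(1) qc(1)] s(2) comp_diff_right[OF qc(1) I fr] qfr
      diff_zero_right[OF qc(1)] comp_Id_left[OF qc(1)] comp_Id_right[OF qc(1)] by simp
  then have qs: "q \<bullet> s = Id C Q"
    using qe hom_comp[OF qc(1) s(1)] hom_Id[OF Q'] Q' unfolding epic_def hom_def by blast
  have "r \<bullet> s \<bullet> q = \<zero>\<^bsub>Hom C G F\<^esub>"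
    using comp_assoc[OF r(1) s(1) qc(1)] s(2) comp_diff_right[OF r(1) I fr]
      comp_assoc[OF r(1) fh r(1)] r(2) comp_Id_left[OF r(1)] comp_Id_right[OF r(1)]
      diff_eq_zero_iff[OF r(1) r(1)] by simp
  also have "\<dots> = \<zero>\<^bsub>Hom C Q F\<^esub> \<bullet> q"
    using comp_zero_left[OF qc(1) F'] by simp
  finally have rs: "r \<bullet> s = \<zero>\<^bsub>Hom C Q F\<^esub>"
    using qe hom_comp[OF r(1) s(1)] hom_zero[OF Q' F'] F' unfolding epic_def hom_def by blast
  have sum: "s \<bullet> q \<oplus>\<^bsub>Hom C G G\<^esub> f \<bullet> r = Id C G"
    using s(2) diff_add_cancel[OF I fr] by simp
  obtain n S \<iota> \<pi> where FS: "is_direct_sum C n S F \<iota> \<pi>" "\<forall>i<n. simple_object C (S i)"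
    using F unfolding semisimple_object_def by blast
  have "\<forall>i<Suc n. simple_object C ((S(n := Q)) i)"
    using FS(2) Q by (auto simp: less_Suc_eq)
  then show ?thesis
    using is_direct_sum_extend[OF FS(1) fh r(1) s(1) qc(1) r(2) qs qc(2) rs sum]
    unfolding semisimple_object_def by blast
qed

lemma semisimple_if_monics_split:
  assumes "finite_length C X" and X: "monics_split X"
  shows "semisimple_object C X"
proof -
  obtain n F f where F: "zero_object C (F 0)" "F n = X"
    "\<forall>i<n. monic C (F i) (F (Suc i)) (f i) \<and>
       (\<exists>Q q. is_cokernel C (F i) (F (Suc i)) (f i) Q q \<and> simple_object C Q)"
    using assms(1) unfolding finite_length_def by blast
  \<comment> \<open>The claim is conditional because splitting is known at the top of the series and
    passes downwards, whereas semisimplicity is built up from the bottom.\<close>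
  have "monics_split (F m) \<Longrightarrow> semisimple_object C (F m)" if "m \<le> n" for m
    using that
  proof (induction m)
    case 0
    then show ?case
      using F(1) zero_object_semisimple by blast
  next
    case (Suc m)
    then obtain Q q where f: "monic C (F m) (F (Suc m)) (f m)"
      and Q: "is_cokernel C (F m) (F (Suc m)) (f m) Q q" "simple_object C Q"
      using F(3) by (metis Suc_le_lessD)
    have "semisimple_object C (F m)"
      using Suc monics_split_subobject[OF _ f] by simp
    then show ?case
      using semisimple_extension[OF _ f Suc.prems(1) Q] by blast
  qed
  then show ?thesis
    using F(2) X by blast
qed

end

section \<open>Splitting of monics into semisimple objects\<close>

context abelian_linear_category
begin

text \<open>Simplicity is a condition on subobjects, so it is applied to the image of
  \<open>p\<close>, formed as the kernel \<open>m\<close> of its cokernel \<open>c\<close>. As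
  \<open>p\<close> factors through the image and is nonzero, the image is all of \<open>S\<close>,
  hence \<open>c\<close> is zero. A difference of maps that vanishes on \<open>p\<close> factors
  through \<open>c\<close> and so vanishes.\<close>

lemma nonzero_to_simple_epic:
  assumes S: "simple_object C S" and p: "\<guillemotleft>p : U \<rightarrow> S\<guillemotright>" and nz: "p \<noteq> \<zero>\<^bsub>Hom C U S\<^esub>"
  shows "epic C U S p"
proof -
  have US: "U \<in> Obj C" "S \<in> Obj C"
    using p by (auto simp: hom_def)
  obtain Q c where c: "is_cokernel C U S p Q c"
    using cokernels_exist p by (meson hom_def)
  note c' = is_cokernelE[OF c US(2)]
  have Q: "Q \<in> Obj C"
    using c'(1) by (simp add: hom_def)
  obtain I m where m: "is_kernel C S Q c I m"
    using kernels_exist c'(1) by (meson hom_def)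
  note m' = is_kernelE[OF m US(2)]
  have I: "I \<in> Obj C"
    using m'(1) by (simp add: hom_def)
  obtain p' where p': "\<guillemotleft>p' : U \<rightarrow> I\<guillemotright>" "m \<bullet> p' = p"
    using m'(3)[OF p c'(2)] by blast
  have "\<not> zero_object C I"
  proof
    assume "zero_object C I"
    then have "p' = \<zero>\<^bsub>Hom C U I\<^esub>"
      using p'(1) hom_zero[OF US(1) I] US(1) by (auto simp: zero_object_def hom_def)
    then show False
      using nz p'(2) comp_zero_right[OF m'(1) US(1)] by simp
  qed
  then have iso: "isomorphism C I S m"
    using S is_kernel_monic[OF m c'(1)] by (auto simp: simple_object_def)
  have c0: "c = \<zero>\<^bsub>Hom C S Q\<^esub>"
    using comp_assoc[OF c'(1) m'(1) isomorphismE(2)[OF iso]] isomorphismE(4)[OF iso]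
      comp_Id_right[OF c'(1)] m'(2) comp_zero_left[OF isomorphismE(2)[OF iso] Q] by simp
  have "g = h" if "Z \<in> Obj C" "g \<in> arr C S Z" "h \<in> arr C S Z" "g \<bullet> p = h \<bullet> p" for Z g h
  proof -
    have g: "\<guillemotleft>g : S \<rightarrow> Z\<guillemotright>" and h: "\<guillemotleft>h : S \<rightarrow> Z\<guillemotright>"
      using that US by (auto simp: hom_def)
    have "(g \<ominus>\<^bsub>Hom C S Z\<^esub> h) \<bullet> p = \<zero>\<^bsub>Hom C U Z\<^esub>"
      using comp_diff_left[OF p g h] that diff_eq_zero_iff[OF hom_comp[OF g p] hom_comp[OF h p]]
      by simp
    then obtain u where "\<guillemotleft>u : Q \<rightarrow> Z\<guillemotright>" "u \<bullet> c = g \<ominus>\<^bsub>Hom C S Z\<^esub> h"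
      using c'(3)[OF hom_diff[OF g h]] by blast
    then show ?thesis
      using c0 comp_zero_right[of u Q Z S] US diff_eq_zero_iff[OF g h] by simp
  qed
  then show ?thesis
    using p by (auto simp: epic_def hom_def)
qed

text \<open>A nonzero \<open>p\<close> is epic, hence the cokernel of some \<open>g\<close>. This
  \<open>g\<close> factors through the kernel \<open>k\<close>, so \<open>z\<close> kills it and
  descends along \<open>p\<close>. If \<open>p\<close> is zero, then \<open>k\<close> has a right
  inverse and \<open>z\<close> is zero.\<close>

lemma factor_through_simple:
  assumes S: "simple_object C S" and p: "\<guillemotleft>p : U \<rightarrow> S\<guillemotright>" and k: "is_kernel C U S p N k"
    and z: "\<guillemotleft>z : U \<rightarrow> Z\<guillemotright>" and zk: "z \<bullet> k = \<zero>\<^bsub>Hom C N Z\<^esub>"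
  shows "\<exists>s. \<guillemotleft>s : S \<rightarrow> Z\<guillemotright> \<and> s \<bullet> p = z"
proof -
  have Ob: "U \<in> Obj C" "S \<in> Obj C" "Z \<in> Obj C"
    using p z by (auto simp: hom_def)
  note k' = is_kernelE[OF k Ob(1)]
  show ?thesis
  proof (cases "p = \<zero>\<^bsub>Hom C U S\<^esub>")
    case True
    then obtain u where u: "\<guillemotleft>u : U \<rightarrow> N\<guillemotright>" "k \<bullet> u = Id C U"
      using k'(3)[OF hom_Id[OF Ob(1)]] comp_Id_right[OF p] by auto
    have "z = \<zero>\<^bsub>Hom C U Z\<^esub>"
      using comp_assoc[OF z k'(1) u(1)] u(2) comp_Id_right[OF z] zk comp_zero_left[OF u(1) Ob(3)]
      by simp
    then show ?thesis
      using comp_zero_left[OF p Ob(3)] hom_zero[OF Ob(2,3)] by auto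
  next
    case False
    then obtain A g where A: "A \<in> Obj C" "g \<in> arr C A U" and g: "is_cokernel C A U g S p"
      using epic_is_cokernel nonzero_to_simple_epic[OF S p] by blast
    have gh: "\<guillemotleft>g : A \<rightarrow> U\<guillemotright>"
      using A Ob by (simp add: hom_def)
    note g' = is_cokernelE[OF g Ob(1)]
    obtain u where u: "\<guillemotleft>u : A \<rightarrow> N\<guillemotright>" "k \<bullet> u = g"
      using k'(3)[OF gh g'(2)] by blast
    have "z \<bullet> g = \<zero>\<^bsub>Hom C A Z\<^esub>"
      using comp_assoc[OF z k'(1) u(1)] u(2) zk comp_zero_left[OF u(1) Ob(3)] by simp
    then show ?thesis
      using g'(3)[OF z] by blast
  qed
qed

text \<open>
  A jointly monic family of maps to simple objects, i.e. a subobject of their direct sum, has a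
  joint retraction. Splitting off the last simple object leaves the kernel of its map, on which the
  remaining maps are jointly monic.
\<close>

lemma jointly_monic_retraction:
  fixes n :: nat
  assumes "\<And>i. i < n \<Longrightarrow> simple_object C (S i)" and "\<And>i. i < n \<Longrightarrow> \<guillemotleft>a i : U \<rightarrow> S i\<guillemotright>"
    and "U \<in> Obj C"
    and "\<And>Z z. \<guillemotleft>z : Z \<rightarrow> U\<guillemotright> \<Longrightarrow> (\<And>i. i < n \<Longrightarrow> a i \<bullet> z = \<zero>\<^bsub>Hom C Z (S i)\<^esub>) \<Longrightarrow> z = \<zero>\<^bsub>Hom C Z U\<^esub>"
  shows "\<exists>b. (\<forall>i<n. \<guillemotleft>b i : S i \<rightarrow> U\<guillemotright>) \<and> (\<Oplus>\<^bsub>Hom C U U\<^esub> i \<in> {..<n}. b i \<bullet> a i) = Id C U"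
  using assms
proof (induction n arbitrary: U a)
  case 0
  \<comment> \<open>For the empty family, joint monicity applied to the identity of \<open>U\<close>
    says that it is zero, which is the value of the empty sum.\<close>
  then show ?case
    using hom_Id by (force simp: abelian_monoid.finsum_empty Hom_abelian_monoid)
next
  case (Suc n)
  note S = Suc.prems(1) and a = Suc.prems(2) and U = Suc.prems(3)
  obtain N k where k: "is_kernel C U (S n) (a n) N k"
    using kernels_exist a[of n] by (meson hom_def lessI)
  note k' = is_kernelE[OF k U]
  have N: "N \<in> Obj C"
    using k'(1) by (simp add: hom_def)
  have ak: "\<guillemotleft>a i \<bullet> k : N \<rightarrow> S i\<guillemotright>" if "i < n" for i
    using hom_comp[OF a k'(1)] that by simp
  have "z = \<zero>\<^bsub>Hom C Z N\<^esub>"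
    if z: "\<guillemotleft>z : Z \<rightarrow> N\<guillemotright>" and 0: "\<And>i. i < n \<Longrightarrow> a i \<bullet> k \<bullet> z = \<zero>\<^bsub>Hom C Z (S i)\<^esub>" for Z z
  proof -
    have "a i \<bullet> (k \<bullet> z) = \<zero>\<^bsub>Hom C Z (S i)\<^esub>" if i: "i < Suc n" for i
    proof -
      have "a n \<bullet> k \<bullet> z = \<zero>\<^bsub>Hom C Z (S n)\<^esub>"
        using k'(2) comp_zero_left[OF z, of "S n"] a[of n] by (simp add: hom_def)
      then show ?thesis
        using i 0[of i] comp_assoc[OF a k'(1) z, of i] by (auto simp: less_Suc_eq)
    qed
    then have "k \<bullet> z = \<zero>\<^bsub>Hom C Z U\<^esub>"
      using Suc.prems(4)[OF hom_comp[OF k'(1) z]] by blast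
    then show ?thesis
      using monic_zero[OF is_kernel_monic[OF k a] z] by simp
  qed
  then obtain b where b: "\<And>i. i < n \<Longrightarrow> \<guillemotleft>b i : S i \<rightarrow> N\<guillemotright>"
    and sum: "(\<Oplus>\<^bsub>Hom C N N\<^esub> i \<in> {..<n}. b i \<bullet> (a i \<bullet> k)) = Id C N"
    using Suc.IH[of "\<lambda>i. a i \<bullet> k" N] S ak N by auto
  have a': "\<guillemotleft>a i : U \<rightarrow> S i\<guillemotright>" if "i < n" for i
    using a that by simp
  have ba: "\<guillemotleft>b i \<bullet> a i : U \<rightarrow> N\<guillemotright>" if "i < n" for i
    using hom_comp[OF b a'] that by simp
  define r where "r = (\<Oplus>\<^bsub>Hom C U N\<^esub> i \<in> {..<n}. b i \<bullet> a i)"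
  have r: "\<guillemotleft>r : U \<rightarrow> N\<guillemotright>"
    unfolding r_def using U N ba by (rule hom_finsum)
  have "r \<bullet> k = (\<Oplus>\<^bsub>Hom C N N\<^esub> i \<in> {..<n}. b i \<bullet> a i \<bullet> k)"
    unfolding r_def by (rule comp_finsum_left[OF k'(1) N ba])
  also have "\<dots> = Id C N"
    unfolding sum[symmetric] using b ak a' k'(1)
    by (intro finsum_Hom_cong N hom_comp[OF b ak] comp_assoc[OF b a' k'(1)])
  finally have rk: "r \<bullet> k = Id C N" .
  have kr: "\<guillemotleft>k \<bullet> r : U \<rightarrow> U\<guillemotright>" and I: "\<guillemotleft>Id C U : U \<rightarrow> U\<guillemotright>"
    using hom_comp[OF k'(1) r] hom_Id[OF U] by auto
  \<comment> \<open>\<open>1 - k r\<close> vanishes on the kernel \<open>k\<close> of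
    \<open>a n\<close>, so it factors as \<open>s \<bullet> a n\<close>; this \<open>s\<close> is
    the coefficient of the last map.\<close>
  have "(Id C U \<ominus>\<^bsub>Hom C U U\<^esub> k \<bullet> r) \<bullet> k = \<zero>\<^bsub>Hom C N U\<^esub>"
    using comp_diff_left[OF k'(1) I kr] comp_assoc[OF k'(1) r k'(1)] rk comp_Id_left[OF k'(1)]
      comp_Id_right[OF k'(1)] diff_eq_zero_iff[OF k'(1) k'(1)] by simp
  then obtain s where s: "\<guillemotleft>s : S n \<rightarrow> U\<guillemotright>" "s \<bullet> a n = Id C U \<ominus>\<^bsub>Hom C U U\<^esub> k \<bullet> r"
    using factor_through_simple[OF S a k hom_diff[OF I kr]] by auto
  define b' where "b' = (\<lambda>i. k \<bullet> b i)(n := s)"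
  have b': "\<guillemotleft>b' i : S i \<rightarrow> U\<guillemotright>" if "i < Suc n" for i
    using that hom_comp[OF k'(1) b] s(1) by (auto simp: b'_def)
  have "(\<Oplus>\<^bsub>Hom C U U\<^esub> i \<in> {..<n}. b' i \<bullet> a i) = (\<Oplus>\<^bsub>Hom C U U\<^esub> i \<in> {..<n}. k \<bullet> (b i \<bullet> a i))"
    using U hom_comp[OF k'(1) ba] comp_assoc[OF k'(1) b a']
    by (intro finsum_Hom_cong) (auto simp: b'_def)
  also have "\<dots> = k \<bullet> r"
    unfolding r_def using comp_finsum_right[OF k'(1) U ba] by simp
  finally have "(\<Oplus>\<^bsub>Hom C U U\<^esub> i \<in> {..<Suc n}. b' i \<bullet> a i) = s \<bullet> a n \<oplus>\<^bsub>Hom C U U\<^esub> k \<bullet> r"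
    using finsum_Suc_Hom[OF U U hom_comp[OF b' a]] by (simp add: b'_def)
  then have "(\<Oplus>\<^bsub>Hom C U U\<^esub> i \<in> {..<Suc n}. b' i \<bullet> a i) = Id C U"
    using s(2) diff_add_cancel[OF I kr] by simp
  then show ?case
    using b' by blast
qed

text \<open>The identity of \<open>X\<close> is the sum of the
  \<open>\<iota> i \<bullet> \<pi> i\<close>, so the maps \<open>\<pi> i \<bullet> u\<close> are
  jointly monic when \<open>u\<close> is monic. From a joint retraction \<open>b\<close> of them,
  the sum of the \<open>b i \<bullet> \<pi> i\<close> is a retraction of \<open>u\<close>.\<close>

lemma monics_split_if_semisimple:
  assumes "semisimple_object C X"
  shows "monics_split X"
  unfolding monics_split_def
proof (intro allI impI)
  fix U u assume um: "monic C U X u"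
  obtain n S \<iota> \<pi> where X: "is_direct_sum C n S X \<iota> \<pi>" and S: "\<And>i. i < n \<Longrightarrow> simple_object C (S i)"
    using assms unfolding semisimple_object_def by blast
  note D = is_direct_sumE[OF X]
  have u: "\<guillemotleft>u : U \<rightarrow> X\<guillemotright>" and U: "U \<in> Obj C"
    using um by (auto simp: monic_def hom_def)
  have pu: "\<guillemotleft>\<pi> i \<bullet> u : U \<rightarrow> S i\<guillemotright>" if "i < n" for i
    using hom_comp[OF D(3) u] that .
  have "z = \<zero>\<^bsub>Hom C Z U\<^esub>"
    if z: "\<guillemotleft>z : Z \<rightarrow> U\<guillemotright>" and 0: "\<And>i. i < n \<Longrightarrow> \<pi> i \<bullet> u \<bullet> z = \<zero>\<^bsub>Hom C Z (S i)\<^esub>" for Z z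
  proof -
    have Z: "Z \<in> Obj C"
      using z by (simp add: hom_def)
    note uz = hom_comp[OF u z]
    have "u \<bullet> z = (\<Oplus>\<^bsub>Hom C Z X\<^esub> i \<in> {..<n}. \<iota> i \<bullet> \<pi> i \<bullet> (u \<bullet> z))"
      using comp_finsum_left[OF uz D(1), of n "\<lambda>i. \<iota> i \<bullet> \<pi> i", OF hom_comp[OF D(2,3)]] comp_Id_left[OF uz] D(5) by simp
    also have "\<dots> = (\<Oplus>\<^bsub>Hom C Z X\<^esub> i \<in> {..<n}. \<zero>\<^bsub>Hom C Z X\<^esub>)"
    proof (intro finsum_Hom_cong Z D(1) hom_zero)
      fix i assume i: "i < n"
      show "\<iota> i \<bullet> \<pi> i \<bullet> (u \<bullet> z) = \<zero>\<^bsub>Hom C Z X\<^esub>"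
        using comp_assoc[OF D(2,3) uz, OF i i] comp_assoc[OF D(3) u z, OF i] 0[OF i]
          comp_zero_right[OF D(2) Z, OF i] by simp
    qed
    also have "\<dots> = \<zero>\<^bsub>Hom C Z X\<^esub>"
      by (simp add: abelian_monoid.finsum_zero Hom_abelian_monoid Z D(1))
    finally show ?thesis
      using monic_zero[OF um z] by simp
  qed
  then obtain b where b: "\<And>i. i < n \<Longrightarrow> \<guillemotleft>b i : S i \<rightarrow> U\<guillemotright>"
    and sum: "(\<Oplus>\<^bsub>Hom C U U\<^esub> i \<in> {..<n}. b i \<bullet> (\<pi> i \<bullet> u)) = Id C U"
    using jointly_monic_retraction[of n S "\<lambda>i. \<pi> i \<bullet> u" U, OF S pu U] by blast
  define r where "r = (\<Oplus>\<^bsub>Hom C X U\<^esub> i \<in> {..<n}. b i \<bullet> \<pi> i)"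
  have "\<guillemotleft>r : X \<rightarrow> U\<guillemotright>"
    unfolding r_def using D(1) U hom_comp[OF b D(3)] by (rule hom_finsum)
  moreover have "r \<bullet> u = (\<Oplus>\<^bsub>Hom C U U\<^esub> i \<in> {..<n}. b i \<bullet> \<pi> i \<bullet> u)"
    unfolding r_def by (rule comp_finsum_left[OF u U hom_comp[OF b D(3)]])
  moreover have "\<dots> = (\<Oplus>\<^bsub>Hom C U U\<^esub> i \<in> {..<n}. b i \<bullet> (\<pi> i \<bullet> u))"
    by (intro finsum_Hom_cong U hom_comp[OF b pu] comp_assoc[OF b D(3) u])
  ultimately show "\<exists>r. \<guillemotleft>r : X \<rightarrow> U\<guillemotright> \<and> r \<bullet> u = Id C U"
    using sum by auto
qed

end

section \<open>Tensoring with an object that has a dual\<close>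

context monoidal_linear_category
begin

abbreviation unit_obj (\<open>\<I>\<close>) where "\<I> \<equiv> UnitObj C"
abbreviation tensor_obj (infixr \<open>\<otimes>\<^sub>o\<close> 75) where "X \<otimes>\<^sub>o Y \<equiv> X \<boxtimes>\<^bsub>C\<^esub> Y"
abbreviation tensor_arr (infixr \<open>\<otimes>\<^sub>a\<close> 75) where "f \<otimes>\<^sub>a g \<equiv> f \<boxdot>\<^bsub>C\<^esub> g"
abbreviation associator (\<open>\<alpha>\<close>) where "\<alpha> \<equiv> Assoc C"
abbreviation associator' (\<open>\<alpha>''\<close>) where
  "\<alpha>' X Y Z \<equiv> inverse_arr C ((X \<otimes>\<^sub>o Y) \<otimes>\<^sub>o Z) (X \<otimes>\<^sub>o (Y \<otimes>\<^sub>o Z)) (\<alpha> X Y Z)"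
abbreviation right_unitor (\<open>\<rho>\<close>) where "\<rho> \<equiv> RUnit C"
abbreviation right_unitor' (\<open>\<rho>''\<close>) where "\<rho>' X \<equiv> inverse_arr C (X \<otimes>\<^sub>o \<I>) X (\<rho> X)"

section \<open>Functoriality of the tensor product\<close>

lemma hom_tensor:
  "\<guillemotleft>f : X \<rightarrow> Y\<guillemotright> \<Longrightarrow> \<guillemotleft>g : X' \<rightarrow> Y'\<guillemotright> \<Longrightarrow> \<guillemotleft>f \<otimes>\<^sub>a g : X \<otimes>\<^sub>o X' \<rightarrow> Y \<otimes>\<^sub>o Y'\<guillemotright>"
  by (simp add: hom_def TensorObj_closed TensorArr_closed)

lemma tensor_comp:
  "\<guillemotleft>g : Y \<rightarrow> Z\<guillemotright> \<Longrightarrow> \<guillemotleft>f : X \<rightarrow> Y\<guillemotright> \<Longrightarrow> \<guillemotleft>g' : Y' \<rightarrow> Z'\<guillemotright> \<Longrightarrow> \<guillemotleft>f' : X' \<rightarrow> Y'\<guillemotright> \<Longrightarrow>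
    (g \<otimes>\<^sub>a g') \<bullet> (f \<otimes>\<^sub>a f') = (g \<bullet> f) \<otimes>\<^sub>a (g' \<bullet> f')"
  by (auto simp: hom_def TensorArr_Comp[of X Y Z X' Y' Z'])

lemma tensor_Id_comp:
  assumes "X \<in> Obj C" "\<guillemotleft>g : B \<rightarrow> D\<guillemotright>" "\<guillemotleft>f : A \<rightarrow> B\<guillemotright>"
  shows "Id C X \<otimes>\<^sub>a (g \<bullet> f) = (Id C X \<otimes>\<^sub>a g) \<bullet> (Id C X \<otimes>\<^sub>a f)"
  using assms tensor_comp[OF hom_Id hom_Id, of X g B D f A] comp_Id_left[OF hom_Id, of X] by simp

lemma tensor_comp_Id:
  assumes "X \<in> Obj C" "\<guillemotleft>g : B \<rightarrow> D\<guillemotright>" "\<guillemotleft>f : A \<rightarrow> B\<guillemotright>"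
  shows "(g \<bullet> f) \<otimes>\<^sub>a Id C X = (g \<otimes>\<^sub>a Id C X) \<bullet> (f \<otimes>\<^sub>a Id C X)"
  using assms tensor_comp[OF assms(2,3) hom_Id hom_Id, of X] comp_Id_left[OF hom_Id, of X] by simp

lemma interchange:
  assumes f: "\<guillemotleft>f : X \<rightarrow> Y\<guillemotright>" and g: "\<guillemotleft>g : A \<rightarrow> B\<guillemotright>"
  shows "(Id C Y \<otimes>\<^sub>a g) \<bullet> (f \<otimes>\<^sub>a Id C A) = (f \<otimes>\<^sub>a Id C B) \<bullet> (Id C X \<otimes>\<^sub>a g)"
proof -
  have "X \<in> Obj C" "Y \<in> Obj C" "A \<in> Obj C" "B \<in> Obj C"
    using f g by (auto simp: hom_def)
  then show ?thesis
    using tensor_comp[OF hom_Id f g hom_Id] tensor_comp[OF f hom_Id hom_Id g]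
      comp_Id_left[OF f] comp_Id_right[OF f] comp_Id_left[OF g] comp_Id_right[OF g] by simp
qed

lemma isomorphism_Id_tensor:
  assumes X: "X \<in> Obj C" and f: "isomorphism C A B f"
  shows "isomorphism C (X \<otimes>\<^sub>o A) (X \<otimes>\<^sub>o B) (Id C X \<otimes>\<^sub>a f)"
proof -
  note F = isomorphismE[OF f]
  let ?g = "Id C X \<otimes>\<^sub>a inverse_arr C A B f"
  have AB: "A \<in> Obj C" "B \<in> Obj C"
    using F(1) by (auto simp: hom_def)
  have "?g \<bullet> (Id C X \<otimes>\<^sub>a f) = Id C (X \<otimes>\<^sub>o A)" "(Id C X \<otimes>\<^sub>a f) \<bullet> ?g = Id C (X \<otimes>\<^sub>o B)"
    using tensor_Id_comp[OF X F(2,1)] tensor_Id_comp[OF X F(1,2)] F(3,4) X AB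
    by (simp_all add: TensorArr_Id)
  then show ?thesis
    using hom_tensor[OF hom_Id[OF X] F(1)] hom_tensor[OF hom_Id[OF X] F(2)]
    unfolding isomorphism_def hom_def by blast
qed

text \<open>
  For \<open>B\<close> a dual of \<open>A\<close> on the appropriate side, these are the unit and the counit of the
  adjunction between tensoring with \<open>A\<close> and with \<open>B\<close> on the right. The quantum dimension
  composes them for a coevaluation and an evaluation that need not belong to the same duality.
\<close>

definition unit_map :: "'o \<Rightarrow> 'o \<Rightarrow> 'm \<Rightarrow> 'o \<Rightarrow> 'm" where
  "unit_map A B c X = \<alpha>' X A B \<bullet> ((Id C X \<otimes>\<^sub>a c) \<bullet> \<rho>' X)"

definition counit_map :: "'o \<Rightarrow> 'o \<Rightarrow> 'm \<Rightarrow> 'o \<Rightarrow> 'm" where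
  "counit_map A B e X = (\<rho> X \<bullet> (Id C X \<otimes>\<^sub>a e)) \<bullet> \<alpha> X A B"

context
  fixes A B assumes AB: "A \<in> Obj C" "B \<in> Obj C"
begin

lemma hom_unit_map:
  assumes X: "X \<in> Obj C" and c: "\<guillemotleft>c : \<I> \<rightarrow> A \<otimes>\<^sub>o B\<guillemotright>"
  shows "\<guillemotleft>unit_map A B c X : X \<rightarrow> (X \<otimes>\<^sub>o A) \<otimes>\<^sub>o B\<guillemotright>"
  unfolding unit_map_def
  using hom_comp[OF isomorphismE(2)[OF Assoc_iso[OF X AB]]
      hom_comp[OF hom_tensor[OF hom_Id[OF X] c] isomorphismE(2)[OF RUnit_iso[OF X]]]] .

lemma hom_counit_map:
  assumes X: "X \<in> Obj C" and e: "\<guillemotleft>e : A \<otimes>\<^sub>o B \<rightarrow> \<I>\<guillemotright>"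
  shows "\<guillemotleft>counit_map A B e X : (X \<otimes>\<^sub>o A) \<otimes>\<^sub>o B \<rightarrow> X\<guillemotright>"
  unfolding counit_map_def
  using hom_comp[OF hom_comp[OF isomorphismE(1)[OF RUnit_iso[OF X]] hom_tensor[OF hom_Id[OF X] e]]
      isomorphismE(1)[OF Assoc_iso[OF X AB]]] .

lemma tensor_tensor_Id: "\<guillemotleft>f : X \<rightarrow> Y\<guillemotright> \<Longrightarrow>
    \<guillemotleft>(f \<otimes>\<^sub>a Id C A) \<otimes>\<^sub>a Id C B : (X \<otimes>\<^sub>o A) \<otimes>\<^sub>o B \<rightarrow> (Y \<otimes>\<^sub>o A) \<otimes>\<^sub>o B\<guillemotright>"
  using hom_tensor[OF hom_tensor[OF _ hom_Id[OF AB(1)]] hom_Id[OF AB(2)]] .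

text \<open>Three squares are pasted, one for each factor of \<open>unit_map\<close>: the inverse
  right unitor, the interchange of \<open>f\<close> with \<open>c\<close>, and the inverse
  associator.\<close>

lemma unit_map_natural:
  assumes f: "\<guillemotleft>f : X \<rightarrow> Y\<guillemotright>" and c: "\<guillemotleft>c : \<I> \<rightarrow> A \<otimes>\<^sub>o B\<guillemotright>"
  shows "unit_map A B c Y \<bullet> f = ((f \<otimes>\<^sub>a Id C A) \<otimes>\<^sub>a Id C B) \<bullet> unit_map A B c X"
proof -
  have X: "X \<in> Obj C" and Y: "Y \<in> Obj C" and I: "\<I> \<in> Obj C" and T: "A \<otimes>\<^sub>o B \<in> Obj C"
    using f c by (auto simp: hom_def)
  note \<rho>X = isomorphismE[OF RUnit_iso[OF X]] and \<rho>Y = isomorphismE[OF RUnit_iso[OF Y]]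
    and \<alpha>X = isomorphismE[OF Assoc_iso[OF X AB]] and \<alpha>Y = isomorphismE[OF Assoc_iso[OF Y AB]]
  note cX = hom_tensor[OF hom_Id[OF X] c] and cY = hom_tensor[OF hom_Id[OF Y] c]
  note fI = hom_tensor[OF f hom_Id[OF I]] and fT = hom_tensor[OF f hom_Id[OF T]]
    and fAB = tensor_tensor_Id[OF f]
  have 1: "\<rho>' Y \<bullet> f = (f \<otimes>\<^sub>a Id C \<I>) \<bullet> \<rho>' X"
    using RUnit_natural[OF X Y] f
    by (intro inverse_natural[OF RUnit_iso[OF X] RUnit_iso[OF Y] fI f]) (simp add: hom_def)
  have 2: "(Id C Y \<otimes>\<^sub>a c) \<bullet> (f \<otimes>\<^sub>a Id C \<I>) = (f \<otimes>\<^sub>a Id C (A \<otimes>\<^sub>o B)) \<bullet> (Id C X \<otimes>\<^sub>a c)"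
    by (rule interchange[OF f c])
  have 3: "\<alpha>' Y A B \<bullet> (f \<otimes>\<^sub>a Id C (A \<otimes>\<^sub>o B)) = ((f \<otimes>\<^sub>a Id C A) \<otimes>\<^sub>a Id C B) \<bullet> \<alpha>' X A B"
    using Assoc_natural[OF X AB Y AB _ Id_closed[OF AB(1)] Id_closed[OF AB(2)], of f] f AB
    by (intro inverse_natural[OF Assoc_iso[OF X AB] Assoc_iso[OF Y AB] fAB fT])
      (simp add: hom_def TensorArr_Id)
  note 12 = square_comp[OF \<rho>X(2) cX \<rho>Y(2) cY f fI fT 1 2]
  show ?thesis
    unfolding unit_map_def
    by (rule square_comp[OF hom_comp[OF cX \<rho>X(2)] \<alpha>X(2) hom_comp[OF cY \<rho>Y(2)] \<alpha>Y(2) f fT fAB 12 3])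
qed

lemma counit_map_natural:
  assumes f: "\<guillemotleft>f : X \<rightarrow> Y\<guillemotright>" and e: "\<guillemotleft>e : A \<otimes>\<^sub>o B \<rightarrow> \<I>\<guillemotright>"
  shows "counit_map A B e Y \<bullet> ((f \<otimes>\<^sub>a Id C A) \<otimes>\<^sub>a Id C B) = f \<bullet> counit_map A B e X"
proof -
  have X: "X \<in> Obj C" and Y: "Y \<in> Obj C" and I: "\<I> \<in> Obj C" and T: "A \<otimes>\<^sub>o B \<in> Obj C"
    using f e by (auto simp: hom_def)
  note \<rho>X = isomorphismE[OF RUnit_iso[OF X]] and \<rho>Y = isomorphismE[OF RUnit_iso[OF Y]]
    and \<alpha>X = isomorphismE[OF Assoc_iso[OF X AB]] and \<alpha>Y = isomorphismE[OF Assoc_iso[OF Y AB]]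
  note eX = hom_tensor[OF hom_Id[OF X] e] and eY = hom_tensor[OF hom_Id[OF Y] e]
  note fI = hom_tensor[OF f hom_Id[OF I]] and fT = hom_tensor[OF f hom_Id[OF T]]
    and fAB = tensor_tensor_Id[OF f]
  have 1: "\<rho> Y \<bullet> (f \<otimes>\<^sub>a Id C \<I>) = f \<bullet> \<rho> X"
    using RUnit_natural[OF X Y] f by (simp add: hom_def)
  have 2: "(Id C Y \<otimes>\<^sub>a e) \<bullet> (f \<otimes>\<^sub>a Id C (A \<otimes>\<^sub>o B)) = (f \<otimes>\<^sub>a Id C \<I>) \<bullet> (Id C X \<otimes>\<^sub>a e)"
    by (rule interchange[OF f e])
  have 3: "\<alpha> Y A B \<bullet> ((f \<otimes>\<^sub>a Id C A) \<otimes>\<^sub>a Id C B) = (f \<otimes>\<^sub>a Id C (A \<otimes>\<^sub>o B)) \<bullet> \<alpha> X A B"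
    using Assoc_natural[OF X AB Y AB _ Id_closed[OF AB(1)] Id_closed[OF AB(2)], of f] f AB
    by (simp add: hom_def TensorArr_Id)
  note 21 = square_comp[OF eX \<rho>X(1) eY \<rho>Y(1) fT fI f 2 1]
  show ?thesis
    unfolding counit_map_def
    by (rule square_comp[OF \<alpha>X(1) hom_comp[OF \<rho>X(1) eX] \<alpha>Y(1) hom_comp[OF \<rho>Y(1) eY] fAB fT f 3 21])
qed

text \<open>The two associators meet and cancel, which leaves \<open>e \<bullet> c\<close> tensored
  with \<open>X\<close> and conjugated by the right unitor. A scalar passes through both by
  linearity.\<close>

lemma counit_unit_map:
  assumes X: "X \<in> Obj C" and c: "\<guillemotleft>c : \<I> \<rightarrow> A \<otimes>\<^sub>o B\<guillemotright>" and e: "\<guillemotleft>e : A \<otimes>\<^sub>o B \<rightarrow> \<I>\<guillemotright>"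
    and a: "a \<in> carrier K" and ec: "e \<bullet> c = a \<odot>\<^bsub>Hom C \<I> \<I>\<^esub> Id C \<I>"
  shows "counit_map A B e X \<bullet> unit_map A B c X = a \<odot>\<^bsub>Hom C X X\<^esub> Id C X"
proof -
  have I: "\<I> \<in> Obj C" and XI: "X \<otimes>\<^sub>o \<I> \<in> Obj C"
    using X by (simp_all add: UnitObj_closed TensorObj_closed)
  note \<rho> = isomorphismE[OF RUnit_iso[OF X]] and \<alpha> = isomorphismE[OF Assoc_iso[OF X AB]]
  note cX = hom_tensor[OF hom_Id[OF X] c] and eX = hom_tensor[OF hom_Id[OF X] e]
  note c\<rho> = hom_comp[OF cX \<rho>(2)] and \<rho>e = hom_comp[OF \<rho>(1) eX]
  have "counit_map A B e X \<bullet> unit_map A B c X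
      = (\<rho> X \<bullet> (Id C X \<otimes>\<^sub>a e)) \<bullet> ((Id C X \<otimes>\<^sub>a c) \<bullet> \<rho>' X)"
    unfolding counit_map_def unit_map_def
    using comp_assoc[OF \<rho>e \<alpha>(1) hom_comp[OF \<alpha>(2) c\<rho>]] comp_assoc[OF \<alpha>(1,2) c\<rho>] \<alpha>(4)
      comp_Id_left[OF c\<rho>] by simp
  also have "\<dots> = \<rho> X \<bullet> ((Id C X \<otimes>\<^sub>a (e \<bullet> c)) \<bullet> \<rho>' X)"
    using comp_assoc[OF \<rho>(1) eX c\<rho>] comp_assoc[OF eX cX \<rho>(2)] tensor_Id_comp[OF X e c] by simp
  also have "Id C X \<otimes>\<^sub>a (e \<bullet> c) = a \<odot>\<^bsub>Hom C (X \<otimes>\<^sub>o \<I>) (X \<otimes>\<^sub>o \<I>)\<^esub> Id C (X \<otimes>\<^sub>o \<I>)"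
    unfolding ec using TensorArr_smult_right[OF X X I I a] X I by (simp add: Id_closed TensorArr_Id)
  also have "\<rho> X \<bullet> ((a \<odot>\<^bsub>Hom C (X \<otimes>\<^sub>o \<I>) (X \<otimes>\<^sub>o \<I>)\<^esub> Id C (X \<otimes>\<^sub>o \<I>)) \<bullet> \<rho>' X) =
      \<rho> X \<bullet> (a \<odot>\<^bsub>Hom C X (X \<otimes>\<^sub>o \<I>)\<^esub> \<rho>' X)"
    using Comp_smult_left[OF X XI XI a _ Id_closed[OF XI], of "\<rho>' X"] \<rho>(2) comp_Id_left[OF \<rho>(2)]
    by (simp add: hom_def)
  also have "\<dots> = a \<odot>\<^bsub>Hom C X X\<^esub> Id C X"
    using Comp_smult_right[OF X XI X a, of "\<rho>' X" "\<rho> X"] \<rho> by (simp add: hom_def)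
  finally show ?thesis .
qed

end

text \<open>A triangle identity of the adjunction, up to an isomorphism. The triangle axiom trades
  \<open>\<rho> X\<close> for the left unitor of \<open>W\<close>, and the pentagon moves the
  associators into the second factor of \<open>X \<otimes> -\<close>. There the zigzag identity of
  \<open>W\<close> collapses everything, and a composite of three constraint isomorphisms
  remains.\<close>

lemma triangle_map_isomorphism:
  assumes dual: "is_left_dual C D W e c" and X: "X \<in> Obj C"
  shows "isomorphism C (X \<otimes>\<^sub>o W) (X \<otimes>\<^sub>o W)
    ((counit_map W D e X \<otimes>\<^sub>a Id C W) \<bullet> unit_map D W c (X \<otimes>\<^sub>o W))"
proof -
  have D: "D \<in> Obj C" and W: "W \<in> Obj C" and I: "\<I> \<in> Obj C"
    and e: "\<guillemotleft>e : W \<otimes>\<^sub>o D \<rightarrow> \<I>\<guillemotright>" and c: "\<guillemotleft>c : \<I> \<rightarrow> D \<otimes>\<^sub>o W\<guillemotright>"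
    and zigzag: "LUnit C W \<bullet> (e \<otimes>\<^sub>a Id C W) \<bullet> \<alpha>' W D W \<bullet> (Id C W \<otimes>\<^sub>a c) \<bullet> \<rho>' W = Id C W"
    using dual UnitObj_closed by (auto simp: is_left_dual_def hom_def TensorObj_closed)
  define P where "P = X \<otimes>\<^sub>o W"
  have P: "P \<in> Obj C" and WD: "W \<otimes>\<^sub>o D \<in> Obj C" and DW: "D \<otimes>\<^sub>o W \<in> Obj C"
    using X W D by (auto simp: P_def TensorObj_closed)
  note IX = hom_Id[OF X] and IW = hom_Id[OF W]
  note l = isomorphismE(1)[OF LUnit_iso[OF W]]
  note \<rho>X = isomorphismE[OF RUnit_iso[OF X]] and \<rho>P = isomorphismE[OF RUnit_iso[OF P]]
    and \<rho>W = isomorphismE[OF RUnit_iso[OF W]]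
  note \<alpha>XWD = isomorphismE[OF Assoc_iso[OF X W D], folded P_def]
    and \<alpha>X1W = isomorphismE[OF Assoc_iso[OF X I W]]
    and \<alpha>XW1 = isomorphismE[OF Assoc_iso[OF X W I], folded P_def]
    and \<alpha>XTW = isomorphismE[OF Assoc_iso[OF X WD W]]
    and \<alpha>XWT = isomorphismE[OF Assoc_iso[OF X W DW], folded P_def]
    and \<alpha>PDW = isomorphismE[OF Assoc_iso[OF P D W]]
    and \<alpha>WDW = isomorphismE[OF Assoc_iso[OF W D W]]
  note eW = hom_tensor[OF e IW] and We = hom_tensor[OF IW e] and Wc = hom_tensor[OF IW c]
    and Xe = hom_tensor[OF IX e] and Pc = hom_tensor[OF hom_Id[OF P] c]
  note XeW = hom_tensor[OF Xe IW] and X_eW = hom_tensor[OF IX eW] and X_Wc = hom_tensor[OF IX Wc]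
    and Xl = hom_tensor[OF IX l] and \<rho>XW = hom_tensor[OF \<rho>X(1) IW]
    and \<alpha>XWD_W = hom_tensor[OF \<alpha>XWD(1) IW] and X\<alpha> = hom_tensor[OF IX \<alpha>WDW(1)]
    and X\<alpha>' = hom_tensor[OF IX \<alpha>WDW(2)]
  \<comment> \<open>The zigzag composite without its last factor \<open>\<rho>' W\<close>; the
    zigzag identity therefore makes \<open>z\<close> equal to \<open>\<rho> W\<close>.\<close>
  define z where "z = LUnit C W \<bullet> (e \<otimes>\<^sub>a Id C W) \<bullet> \<alpha>' W D W \<bullet> (Id C W \<otimes>\<^sub>a c)"
  have z: "\<guillemotleft>z : W \<otimes>\<^sub>o \<I> \<rightarrow> W\<guillemotright>"
    unfolding z_def by (rule hom_comp l eW \<alpha>WDW(2) Wc)+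
  have z\<rho>: "z = \<rho> W"
    using comp_assoc[OF z \<rho>W(2,1)] zigzag \<rho>W(3) comp_Id_right[OF z] comp_Id_left[OF \<rho>W(1)]
    by (simp add: z_def)
  have 1: "counit_map W D e X \<otimes>\<^sub>a Id C W =
      (\<rho> X \<otimes>\<^sub>a Id C W) \<bullet> ((Id C X \<otimes>\<^sub>a e) \<otimes>\<^sub>a Id C W) \<bullet> (\<alpha> X W D \<otimes>\<^sub>a Id C W)"
    unfolding counit_map_def
    using tensor_comp_Id[OF W hom_comp[OF \<rho>X(1) Xe] \<alpha>XWD(1)] tensor_comp_Id[OF W \<rho>X(1) Xe]
    by simp
  have 2: "\<alpha> X \<I> W \<bullet> ((Id C X \<otimes>\<^sub>a e) \<otimes>\<^sub>a Id C W) = (Id C X \<otimes>\<^sub>a (e \<otimes>\<^sub>a Id C W)) \<bullet> \<alpha> X (W \<otimes>\<^sub>o D) W"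
    using Assoc_natural[OF X WD W X I W] IX IW e by (simp add: hom_def)
  have 3: "(\<rho> X \<otimes>\<^sub>a Id C W) \<bullet> ((Id C X \<otimes>\<^sub>a e) \<otimes>\<^sub>a Id C W) =
      (Id C X \<otimes>\<^sub>a LUnit C W) \<bullet> (Id C X \<otimes>\<^sub>a (e \<otimes>\<^sub>a Id C W)) \<bullet> \<alpha> X (W \<otimes>\<^sub>o D) W"
    using triangle[OF X W] comp_assoc[OF Xl \<alpha>X1W(1) XeW] comp_assoc[OF Xl X_eW \<alpha>XTW(1)] 2 by simp
  \<comment> \<open>This is the pentagon solved for other factors: both sides agree after
    composition with the isomorphism \<open>Id C X \<otimes>\<^sub>a \<alpha> W D W\<close>, which
    can be cancelled.\<close>
  have 4: "\<alpha> X (W \<otimes>\<^sub>o D) W \<bullet> (\<alpha> X W D \<otimes>\<^sub>a Id C W) \<bullet> \<alpha>' P D W =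
      (Id C X \<otimes>\<^sub>a \<alpha>' W D W) \<bullet> \<alpha> X W (D \<otimes>\<^sub>o W)" (is "?L = ?R")
  proof -
    have aa: "\<guillemotleft>\<alpha> X (W \<otimes>\<^sub>o D) W \<bullet> (\<alpha> X W D \<otimes>\<^sub>a Id C W) : (P \<otimes>\<^sub>o D) \<otimes>\<^sub>o W \<rightarrow> X \<otimes>\<^sub>o ((W \<otimes>\<^sub>o D) \<otimes>\<^sub>o W)\<guillemotright>"
      (is "\<guillemotleft>?aa : _ \<rightarrow> _\<guillemotright>")
      by (rule hom_comp[OF \<alpha>XTW(1) \<alpha>XWD_W])
    have iso: "isomorphism C (X \<otimes>\<^sub>o ((W \<otimes>\<^sub>o D) \<otimes>\<^sub>o W)) (X \<otimes>\<^sub>o (W \<otimes>\<^sub>o (D \<otimes>\<^sub>o W))) (Id C X \<otimes>\<^sub>a \<alpha> W D W)"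
      by (rule isomorphism_Id_tensor[OF X Assoc_iso[OF W D W]])
    have pent: "(Id C X \<otimes>\<^sub>a \<alpha> W D W) \<bullet> ?aa = \<alpha> X W (D \<otimes>\<^sub>o W) \<bullet> \<alpha> P D W"
      using pentagon[OF X W D W] comp_assoc[OF X\<alpha> \<alpha>XTW(1) \<alpha>XWD_W] by (simp add: P_def)
    have "(Id C X \<otimes>\<^sub>a \<alpha> W D W) \<bullet> ?L = \<alpha> X W (D \<otimes>\<^sub>o W)"
      using comp_assoc[OF X\<alpha> aa \<alpha>PDW(2)] pent comp_assoc[OF \<alpha>XWT(1) \<alpha>PDW(1,2)] \<alpha>PDW(4)
        comp_Id_right[OF \<alpha>XWT(1)] by simp
    moreover have "(Id C X \<otimes>\<^sub>a \<alpha> W D W) \<bullet> ?R = \<alpha> X W (D \<otimes>\<^sub>o W)"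
      using comp_assoc[OF X\<alpha> X\<alpha>' \<alpha>XWT(1)] tensor_Id_comp[OF X \<alpha>WDW(1,2)] \<alpha>WDW(4)
        comp_Id_left[OF \<alpha>XWT(1)] X W DW by (simp add: TensorArr_Id TensorObj_closed)
    ultimately show ?thesis
      using isomorphism_left_cancel[OF iso hom_comp[OF aa \<alpha>PDW(2)] hom_comp[OF X\<alpha>' \<alpha>XWT(1)]] by simp
  qed
  have 5: "\<alpha> X W (D \<otimes>\<^sub>o W) \<bullet> (Id C P \<otimes>\<^sub>a c) = (Id C X \<otimes>\<^sub>a (Id C W \<otimes>\<^sub>a c)) \<bullet> \<alpha> X W \<I>"
    using Assoc_natural[OF X W I X W DW, of "Id C X" "Id C W" c] IX IW c X W
    by (simp add: hom_def P_def TensorArr_Id)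
  have 6: "Id C X \<otimes>\<^sub>a z = (Id C X \<otimes>\<^sub>a LUnit C W) \<bullet> (Id C X \<otimes>\<^sub>a (e \<otimes>\<^sub>a Id C W))
      \<bullet> (Id C X \<otimes>\<^sub>a \<alpha>' W D W) \<bullet> (Id C X \<otimes>\<^sub>a (Id C W \<otimes>\<^sub>a c))"
    unfolding z_def
    using tensor_Id_comp[OF X hom_comp[OF hom_comp[OF l eW] \<alpha>WDW(2)] Wc]
      tensor_Id_comp[OF X hom_comp[OF l eW] \<alpha>WDW(2)] tensor_Id_comp[OF X l eW] by simp
  let ?p = "(Id C X \<otimes>\<^sub>a LUnit C W) \<bullet> (Id C X \<otimes>\<^sub>a (e \<otimes>\<^sub>a Id C W))"
  note p = hom_comp[OF Xl X_eW]
  note c\<rho> = hom_comp[OF Pc \<rho>P(2)]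
  have "(counit_map W D e X \<otimes>\<^sub>a Id C W) \<bullet> unit_map D W c P =
      ?p \<bullet> \<alpha> X (W \<otimes>\<^sub>o D) W \<bullet> (\<alpha> X W D \<otimes>\<^sub>a Id C W) \<bullet> (\<alpha>' P D W \<bullet> ((Id C P \<otimes>\<^sub>a c) \<bullet> \<rho>' P))"
    unfolding 1 3 unit_map_def ..
  also have "\<dots> = ?p \<bullet> (\<alpha> X (W \<otimes>\<^sub>o D) W \<bullet> (\<alpha> X W D \<otimes>\<^sub>a Id C W) \<bullet> \<alpha>' P D W) \<bullet> ((Id C P \<otimes>\<^sub>a c) \<bullet> \<rho>' P)"
    using comp_assoc[OF p \<alpha>XTW(1) \<alpha>XWD_W] comp_assoc[OF hom_comp[OF p hom_comp[OF \<alpha>XTW(1) \<alpha>XWD_W]] \<alpha>PDW(2) c\<rho>]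
      comp_assoc[OF p hom_comp[OF \<alpha>XTW(1) \<alpha>XWD_W] \<alpha>PDW(2)] by simp
  also have "\<dots> = ?p \<bullet> (Id C X \<otimes>\<^sub>a \<alpha>' W D W) \<bullet> \<alpha> X W (D \<otimes>\<^sub>o W) \<bullet> ((Id C P \<otimes>\<^sub>a c) \<bullet> \<rho>' P)"
    unfolding 4 using comp_assoc[OF p X\<alpha>' \<alpha>XWT(1)] by simp
  also have "\<dots> = ?p \<bullet> (Id C X \<otimes>\<^sub>a \<alpha>' W D W) \<bullet> ((Id C X \<otimes>\<^sub>a (Id C W \<otimes>\<^sub>a c)) \<bullet> \<alpha> X W \<I> \<bullet> \<rho>' P)"
    unfolding 5[symmetric]
    using comp_assoc[OF hom_comp[OF p X\<alpha>'] \<alpha>XWT(1) c\<rho>] comp_assoc[OF \<alpha>XWT(1) Pc \<rho>P(2)] by simp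
  also have "\<dots> = (Id C X \<otimes>\<^sub>a z) \<bullet> (\<alpha> X W \<I> \<bullet> \<rho>' P)"
    unfolding 6
    using comp_assoc[OF hom_comp[OF p X\<alpha>'] X_Wc hom_comp[OF \<alpha>XW1(1) \<rho>P(2)]]
      comp_assoc[OF X_Wc \<alpha>XW1(1) \<rho>P(2)] by simp
  finally have *: "(counit_map W D e X \<otimes>\<^sub>a Id C W) \<bullet> unit_map D W c P =
      (Id C X \<otimes>\<^sub>a \<rho> W) \<bullet> (\<alpha> X W \<I> \<bullet> \<rho>' P)"
    unfolding z\<rho> .
  show ?thesis
    unfolding P_def[symmetric] *
    using isomorphism_comp[OF isomorphism_comp[OF isomorphism_inverse[OF RUnit_iso[OF P]]
          Assoc_iso[OF X W I, folded P_def]] isomorphism_Id_tensor[OF X RUnit_iso[OF W]]]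
    by (simp add: P_def)
qed

text \<open>
  For injectivity of the transposition
  \<open>Hom(Z, X \<otimes> W) \<rightarrow> Hom(Z \<otimes> D, X)\<close> it suffices that the composite of unit and counit is an
  isomorphism, so the coherence between the unit constraint and the associator is not needed.
\<close>

lemma monic_tensor_Id:
  assumes dual: "is_left_dual C D W e c" and f: "monic C X Y f"
  shows "monic C (X \<otimes>\<^sub>o W) (Y \<otimes>\<^sub>o W) (f \<otimes>\<^sub>a Id C W)"
proof -
  have D: "D \<in> Obj C" and W: "W \<in> Obj C"
    and e: "\<guillemotleft>e : W \<otimes>\<^sub>o D \<rightarrow> \<I>\<guillemotright>" and c: "\<guillemotleft>c : \<I> \<rightarrow> D \<otimes>\<^sub>o W\<guillemotright>"
    using dual UnitObj_closed by (auto simp: is_left_dual_def hom_def TensorObj_closed)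
  have fh: "\<guillemotleft>f : X \<rightarrow> Y\<guillemotright>"
    using f by (simp add: monic_def hom_def)
  then have X: "X \<in> Obj C" and Y: "Y \<in> Obj C"
    by (auto simp: hom_def)
  then have XW: "X \<otimes>\<^sub>o W \<in> Obj C"
    using W by (simp add: TensorObj_closed)
  note IW = hom_Id[OF W] and ID = hom_Id[OF D]
  note fW = hom_tensor[OF fh IW]
  note fWD = hom_tensor[OF fW ID]
  let ?\<epsilon> = "counit_map W D e" and ?\<eta> = "unit_map D W c"
  note \<epsilon>X = hom_counit_map[OF W D X e] and \<epsilon>Y = hom_counit_map[OF W D Y e]
  \<comment> \<open>\<open>?\<epsilon> X \<bullet> (u \<otimes>\<^sub>a Id C D)\<close> is the
    transpose of \<open>u\<close>. By naturality of the counit, \<open>f\<close> after it depends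
    only on \<open>(f \<otimes>\<^sub>a Id C W) \<bullet> u\<close>.\<close>
  have adjunct: "f \<bullet> (?\<epsilon> X \<bullet> (u \<otimes>\<^sub>a Id C D)) = ?\<epsilon> Y \<bullet> (((f \<otimes>\<^sub>a Id C W) \<bullet> u) \<otimes>\<^sub>a Id C D)"
    if u: "\<guillemotleft>u : Z \<rightarrow> X \<otimes>\<^sub>o W\<guillemotright>" for Z u
  proof -
    note uD = hom_tensor[OF u ID]
    show ?thesis
      using comp_assoc[OF fh \<epsilon>X uD] comp_assoc[OF \<epsilon>Y fWD uD] counit_map_natural[OF W D fh e]
        tensor_comp_Id[OF D fW u] by simp
  qed
  \<comment> \<open>Transposing back recovers \<open>u\<close> followed by the isomorphism of
    \<open>triangle_map_isomorphism\<close>; this is naturality of the unit at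
    \<open>u\<close>.\<close>
  have transpose: "((?\<epsilon> X \<bullet> (u \<otimes>\<^sub>a Id C D)) \<otimes>\<^sub>a Id C W) \<bullet> ?\<eta> Z =
      (?\<epsilon> X \<otimes>\<^sub>a Id C W) \<bullet> ?\<eta> (X \<otimes>\<^sub>o W) \<bullet> u"
    if u: "\<guillemotleft>u : Z \<rightarrow> X \<otimes>\<^sub>o W\<guillemotright>" for Z u
  proof -
    have Z: "Z \<in> Obj C"
      using u by (simp add: hom_def)
    note uD = hom_tensor[OF u ID] and \<epsilon>W = hom_tensor[OF \<epsilon>X IW]
    show ?thesis
      using tensor_comp_Id[OF W \<epsilon>X uD] comp_assoc[OF \<epsilon>W hom_tensor[OF uD IW] hom_unit_map[OF D W Z c]]
        unit_map_natural[OF D W u c] comp_assoc[OF \<epsilon>W hom_unit_map[OF D W XW c] u] by simp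
  qed
  have "u = v" if "Z \<in> Obj C" "u \<in> arr C Z (X \<otimes>\<^sub>o W)" "v \<in> arr C Z (X \<otimes>\<^sub>o W)"
    and eq: "(f \<otimes>\<^sub>a Id C W) \<bullet> u = (f \<otimes>\<^sub>a Id C W) \<bullet> v" for Z u v
  proof -
    have u: "\<guillemotleft>u : Z \<rightarrow> X \<otimes>\<^sub>o W\<guillemotright>" and v: "\<guillemotleft>v : Z \<rightarrow> X \<otimes>\<^sub>o W\<guillemotright>"
      using that XW by (auto simp: hom_def)
    have "?\<epsilon> X \<bullet> (u \<otimes>\<^sub>a Id C D) = ?\<epsilon> X \<bullet> (v \<otimes>\<^sub>a Id C D)"
      using adjunct[OF u] adjunct[OF v] eq f hom_comp[OF \<epsilon>X hom_tensor[OF u ID]]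
        hom_comp[OF \<epsilon>X hom_tensor[OF v ID]] unfolding monic_def hom_def by metis
    then have "(?\<epsilon> X \<otimes>\<^sub>a Id C W) \<bullet> ?\<eta> (X \<otimes>\<^sub>o W) \<bullet> u = (?\<epsilon> X \<otimes>\<^sub>a Id C W) \<bullet> ?\<eta> (X \<otimes>\<^sub>o W) \<bullet> v"
      using transpose[OF u] transpose[OF v] by simp
    then show ?thesis
      by (rule isomorphism_left_cancel[OF triangle_map_isomorphism[OF dual X] u v])
  qed
  then show ?thesis
    using fW unfolding monic_def hom_def by blast
qed

text \<open>To be used with \<open>W\<close> as \<open>A\<close>, \<open>Dual C W\<close> as
  \<open>B\<close>, the coevaluation of \<open>W\<close> as \<open>c\<close>, and as
  \<open>e\<close> the evaluation of \<open>Dual C W\<close> after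
  \<open>i \<otimes>\<^sub>a Id C (Dual C W)\<close>; the scalar \<open>a\<close> is then the
  quantum dimension.\<close>

lemma retraction_from_partial_trace:
  assumes A: "A \<in> Obj C" and B: "B \<in> Obj C"
    and c: "\<guillemotleft>c : \<I> \<rightarrow> A \<otimes>\<^sub>o B\<guillemotright>" and e: "\<guillemotleft>e : A \<otimes>\<^sub>o B \<rightarrow> \<I>\<guillemotright>"
    and a: "a \<in> carrier K" "a \<noteq> \<zero>\<^bsub>K\<^esub>" and ec: "e \<bullet> c = a \<odot>\<^bsub>Hom C \<I> \<I>\<^esub> Id C \<I>"
    and f: "\<guillemotleft>f : X \<rightarrow> Y\<guillemotright>" and r: "\<guillemotleft>r : Y \<otimes>\<^sub>o A \<rightarrow> X \<otimes>\<^sub>o A\<guillemotright>"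
    and rf: "r \<bullet> (f \<otimes>\<^sub>a Id C A) = Id C (X \<otimes>\<^sub>o A)"
  shows "\<exists>r'. \<guillemotleft>r' : Y \<rightarrow> X\<guillemotright> \<and> r' \<bullet> f = Id C X"
proof -
  have X: "X \<in> Obj C" and Y: "Y \<in> Obj C"
    using f by (auto simp: hom_def)
  note IA = hom_Id[OF A] and IB = hom_Id[OF B]
  note fA = hom_tensor[OF f IA] and rB = hom_tensor[OF r IB]
  note fAB = hom_tensor[OF fA IB]
  let ?\<eta> = "unit_map A B c" and ?\<epsilon> = "counit_map A B e X"
  note \<epsilon> = hom_counit_map[OF A B X e]
    and \<eta>X = hom_unit_map[OF A B X c] and \<eta>Y = hom_unit_map[OF A B Y c]
  define t where "t = ?\<epsilon> \<bullet> ((r \<otimes>\<^sub>a Id C B) \<bullet> ?\<eta> Y)"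
  have t: "\<guillemotleft>t : Y \<rightarrow> X\<guillemotright>"
    unfolding t_def by (rule hom_comp \<epsilon> rB \<eta>Y)+
  \<comment> \<open>Naturality of the unit slides \<open>f\<close> to the other side of
    \<open>c\<close>, where it meets \<open>r\<close> inside the factor tensored with
    \<open>B\<close> and is cancelled.\<close>
  have "(r \<otimes>\<^sub>a Id C B) \<bullet> ?\<eta> Y \<bullet> f = (r \<otimes>\<^sub>a Id C B) \<bullet> (((f \<otimes>\<^sub>a Id C A) \<otimes>\<^sub>a Id C B) \<bullet> ?\<eta> X)"
    using comp_assoc[OF rB \<eta>Y f] unit_map_natural[OF A B f c] by simp
  also have "\<dots> = ?\<eta> X"
    using comp_assoc[OF rB fAB \<eta>X] tensor_comp_Id[OF B r fA] rf comp_Id_left[OF \<eta>X] X A B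
    by (simp add: TensorArr_Id TensorObj_closed)
  finally have tf: "t \<bullet> f = a \<odot>\<^bsub>Hom C X X\<^esub> Id C X"
    unfolding t_def using comp_assoc[OF \<epsilon> hom_comp[OF rB \<eta>Y] f] counit_unit_map[OF A B X c e a(1) ec]
    by simp
  have inv: "inv\<^bsub>K\<^esub> a \<in> carrier K" "inv\<^bsub>K\<^esub> a \<otimes>\<^bsub>K\<^esub> a = \<one>\<^bsub>K\<^esub>"
    using a K.field_Units by (auto intro: K.Units_inv_closed K.Units_l_inv)
  have "(inv\<^bsub>K\<^esub> a \<odot>\<^bsub>Hom C Y X\<^esub> t) \<bullet> f = Id C X"
    using Comp_smult_left[OF X Y X inv(1), of f t] f t tf inv a(1) X hom_Id[OF X]
      module.smult_assoc1[OF Hom_module[OF X X], of "inv\<^bsub>K\<^esub> a" a "Id C X"]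
      module.smult_one[OF Hom_module[OF X X], of "Id C X"] by (simp add: hom_def)
  then show ?thesis
    using hom_smult[OF inv(1) t] by blast
qed

end

section \<open>The quantum dimension and the descent of splitting to a tensor factor\<close>

context rigid_tensor_category
begin

text \<open>\<open>quantum_dim\<close> is a definite description. Surjectivity of the map from
  scalars to endomorphisms of the unit object gives existence, injectivity gives uniqueness.\<close>

lemma quantum_dim_eq:
  assumes W: "W \<in> Obj C" and i: "\<guillemotleft>i : W \<rightarrow> Dual C (Dual C W)\<guillemotright>"
  shows "quantum_dim K C W i \<in> carrier K"
    and "Ev C (Dual C W) \<bullet> (i \<otimes>\<^sub>a Id C (Dual C W)) \<bullet> Coev C W =
      quantum_dim K C W i \<odot>\<^bsub>Hom C \<I> \<I>\<^esub> Id C \<I>"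
proof -
  let ?t = "Ev C (Dual C W) \<bullet> (i \<otimes>\<^sub>a Id C (Dual C W)) \<bullet> Coev C W"
  have W': "Dual C W \<in> Obj C"
    and ev: "\<guillemotleft>Ev C (Dual C W) : Dual C (Dual C W) \<otimes>\<^sub>o Dual C W \<rightarrow> \<I>\<guillemotright>"
    and coev: "\<guillemotleft>Coev C W : \<I> \<rightarrow> W \<otimes>\<^sub>o Dual C W\<guillemotright>"
    using left_dual[OF W] left_dual[of "Dual C W"] UnitObj_closed
    by (auto simp: is_left_dual_def hom_def TensorObj_closed)
  have "?t \<in> arr C \<I> \<I>"
    using hom_comp[OF hom_comp[OF ev hom_tensor[OF i hom_Id[OF W']]] coev] by (simp add: hom_def)
  then obtain a where "a \<in> carrier K" "a \<odot>\<^bsub>Hom C \<I> \<I>\<^esub> Id C \<I> = ?t"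
    using bij_betw_imp_surj_on[OF End_UnitObj] by (metis (no_types, lifting) imageE)
  then have "\<exists>!a. a \<in> carrier K \<and> a \<odot>\<^bsub>Hom C \<I> \<I>\<^esub> Id C \<I> = ?t"
    using inj_onD[OF bij_betw_imp_inj_on[OF End_UnitObj]] by (intro ex1I[of _ a]) auto
  from theI'[OF this] show "quantum_dim K C W i \<in> carrier K"
    "?t = quantum_dim K C W i \<odot>\<^bsub>Hom C \<I> \<I>\<^esub> Id C \<I>"
    unfolding quantum_dim_def by simp_all
qed

lemma monics_split_tensor_factor:
  assumes W: "W \<in> Obj C" and i: "\<guillemotleft>i : W \<rightarrow> Dual C (Dual C W)\<guillemotright>"
    and VW: "monics_split (V \<otimes>\<^sub>o W)" and dim: "quantum_dim K C W i \<noteq> \<zero>\<^bsub>K\<^esub>"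
  shows "monics_split V"
  unfolding monics_split_def
proof (intro allI impI)
  fix U f assume f: "monic C U V f"
  \<comment> \<open>\<open>W\<close> must be the left dual in this pair, so the pair comes from
    \<open>right_dual\<close>; its \<open>e\<close> and \<open>c\<close> are not the maps used for
    the trace below.\<close>
  obtain D e c where "is_left_dual C D W e c"
    using right_dual[OF W] by blast
  then obtain r where r: "\<guillemotleft>r : V \<otimes>\<^sub>o W \<rightarrow> U \<otimes>\<^sub>o W\<guillemotright>" "r \<bullet> (f \<otimes>\<^sub>a Id C W) = Id C (U \<otimes>\<^sub>o W)"
    using monic_tensor_Id[OF _ f] VW unfolding monics_split_def by blast
  have W': "Dual C W \<in> Obj C"
    and ev: "\<guillemotleft>Ev C (Dual C W) : Dual C (Dual C W) \<otimes>\<^sub>o Dual C W \<rightarrow> \<I>\<guillemotright>"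
    and coev: "\<guillemotleft>Coev C W : \<I> \<rightarrow> W \<otimes>\<^sub>o Dual C W\<guillemotright>"
    using left_dual[OF W] left_dual[of "Dual C W"] UnitObj_closed
    by (auto simp: is_left_dual_def hom_def TensorObj_closed)
  have "\<guillemotleft>f : U \<rightarrow> V\<guillemotright>"
    using f by (simp add: monic_def hom_def)
  then show "\<exists>r. \<guillemotleft>r : V \<rightarrow> U\<guillemotright> \<and> r \<bullet> f = Id C U"
    using retraction_from_partial_trace[OF W W' coev hom_comp[OF ev hom_tensor[OF i hom_Id[OF W']]]
        quantum_dim_eq(1)[OF W i] dim quantum_dim_eq(2)[OF W i] _ r] by blast
qed

end

theorem theorem2p3:
  fixes K :: "('k, 'r) ring_scheme"
    and C :: "('k, 'o, 'm, 'z) rigid_cat_scheme"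
    and V W :: 'o and i :: 'm
  assumes "rigid_tensor_category K C"
    and "V \<in> Obj C" and "W \<in> Obj C"
    and "isomorphism C W (Dual C (Dual C W)) i"
    and "semisimple_object C (V \<boxtimes>\<^bsub>C\<^esub> W)"
    and "quantum_dim K C W i \<noteq> \<zero>\<^bsub>K\<^esub>"
  shows "semisimple_object C V"
proof -
  interpret rigid_tensor_category K C
    by (rule assms(1))
  have "monics_split V"
    by (rule monics_split_tensor_factor[OF assms(3) isomorphismE(1)[OF assms(4)]
          monics_split_if_semisimple[OF assms(5)] assms(6)])
  then show ?thesis
    by (rule semisimple_if_monics_split[OF finite_length[OF assms(2)]])
qed

end
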